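(* Every realizable rank-$4$ hypermodular matroid $M$ is a restriction of a realizable rank-$4$ modular matroid; that is, there is a realizable rank-$4$ modular matroid $N$ with $E(M)\subseteq E(N)$ and $N|_{E(M)}=M$.
   Context: All matroids are finite. A matroid is realizable if it is representable over some field. A pair of flats $\{A,B\}$ is modular if $r(A\cup B)+r(A\cap B)=r(A)+r(B)$; a matroid is modular if every pair of flats is modular. A matroid of rank $k\ge3$ is hypermodular if every pair of two flats of rank $k-1$ is a modular pair. *)

theory Defs
  imports "HOL-Algebra.Ring" "HOL-Library.Infinite_Typeclass"
begin

record 'a matroid =
  ground :: "'a set"
  indep :: "'a set set"

locale finite_matroid =
  fixes M :: "'a matroid"
  assumes finite_ground: "finite (ground M)"
    and indep_subset: "I \<in> indep M \<Longrightarrow> I \<subseteq> ground M"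
    and indep_empty: "{} \<in> indep M"
    and indep_hereditary: "\<lbrakk>I \<in> indep M; J \<subseteq> I\<rbrakk> \<Longrightarrow> J \<in> indep M"
    and indep_augment:
      "\<lbrakk>I \<in> indep M; J \<in> indep M; card I < card J\<rbrakk> \<Longrightarrow> \<exists>x \<in> J - I. insert x I \<in> indep M"

definition rk :: "'a matroid \<Rightarrow> 'a set \<Rightarrow> nat" where
  "rk M X = Max {card I | I. I \<in> indep M \<and> I \<subseteq> X}"

definition flat :: "'a matroid \<Rightarrow> 'a set \<Rightarrow> bool" where
  "flat M A \<longleftrightarrow> A \<subseteq> ground M \<and> (\<forall>x \<in> ground M - A. rk M A < rk M (insert x A))"

definition modular_pair :: "'a matroid \<Rightarrow> 'a set \<Rightarrow> 'a set \<Rightarrow> bool" where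
  "modular_pair M A B \<longleftrightarrow> rk M (A \<union> B) + rk M (A \<inter> B) = rk M A + rk M B"

definition modular :: "'a matroid \<Rightarrow> bool" where
  "modular M \<longleftrightarrow> (\<forall>A B. flat M A \<and> flat M B \<longrightarrow> modular_pair M A B)"

definition hypermodular :: "'a matroid \<Rightarrow> bool" where
  "hypermodular M \<longleftrightarrow> rk M (ground M) \<ge> 3 \<and>
     (\<forall>A B. flat M A \<and> flat M B \<and>
        rk M A = rk M (ground M) - 1 \<and> rk M B = rk M (ground M) - 1 \<longrightarrow> modular_pair M A B)"

definition restriction :: "'a matroid \<Rightarrow> 'a set \<Rightarrow> 'a matroid" where
  "restriction M X = \<lparr>ground = X, indep = {I \<in> indep M. I \<subseteq> X}\<rparr>"

text \<open>
  The columns \<open>v e\<close> of an \<open>n\<close>-rowed matrix over \<open>K\<close>, for \<open>e \<in> S\<close>, are linearly independent as a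
  family: equal columns at distinct indices are dependent (they represent parallel elements), and
  a zero column is dependent (it represents a loop).
\<close>

definition lin_indep_family ::
    "'k ring \<Rightarrow> nat \<Rightarrow> ('a \<Rightarrow> nat \<Rightarrow> 'k) \<Rightarrow> 'a set \<Rightarrow> bool" where
  "lin_indep_family K n v S \<longleftrightarrow>
     (\<forall>c \<in> S \<rightarrow> carrier K.
        (\<forall>i<n. (\<Oplus>\<^bsub>K\<^esub>e\<in>S. c e \<otimes>\<^bsub>K\<^esub> v e i) = \<zero>\<^bsub>K\<^esub>) \<longrightarrow> (\<forall>e \<in> S. c e = \<zero>\<^bsub>K\<^esub>))"

definition representable_over :: "'k ring \<Rightarrow> 'a matroid \<Rightarrow> bool" where
  "representable_over K M \<longleftrightarrow>
     (\<exists>n (v :: 'a \<Rightarrow> nat \<Rightarrow> 'k).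
        (\<forall>e \<in> ground M. \<forall>i<n. v e i \<in> carrier K) \<and>
        (\<forall>S. S \<subseteq> ground M \<longrightarrow> (S \<in> indep M \<longleftrightarrow> lin_indep_family K n v S)))"

text \<open>
  HOL cannot quantify over types inside a formula, so the type holding the elements of the field
  is an explicit parameter. As a hypothesis, \<open>realizable TYPE('k) M\<close> with \<open>'k\<close> a free type
  variable allows an arbitrary field. As a conclusion, \<open>realizable TYPE(nat) M\<close> loses nothing: a
  representation of a finite matroid has finitely many entries, these generate a countable
  subfield, and every countable field has a copy whose carrier is a set of natural numbers.
\<close>

definition realizable :: "'k itself \<Rightarrow> 'a matroid \<Rightarrow> bool" where
  "realizable _ M \<longleftrightarrow> (\<exists>K :: 'k ring. field K \<and> representable_over K M)"

text \<open>
  An extension \<open>N\<close> with \<open>ground M \<subseteq> ground N\<close> literally needs room for new elements, so extension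
  statements take the element type from class \<open>infinite\<close>; the matroids themselves stay finite.
\<close>

end

theory Submission
  imports Defs "HOL-Algebra.Generated_Fields" "HOL-Algebra.Weak_Morphisms"
    "HOL-Library.Countable_Set"
begin

text \<open>
  Represent \<open>M\<close> by vectors. If \<open>M\<close> is not modular, it has two coplanar lines \<open>A\<close>, \<open>B\<close> with
  \<open>rk (A \<inter> B) = 0\<close>; their spans share a nonzero vector, which we add as a new element \<open>p\<close>. Two planes
  of \<open>M\<close> meet in a line of \<open>M\<close>, so for \<open>a\<close> outside the plane of \<open>A\<close> and \<open>B\<close> the planes \<open>A \<or> a\<close> and
  \<open>B \<or> a\<close> meet in a line of \<open>M\<close> through \<open>a\<close> and \<open>p\<close>; using such a line in place of \<open>B\<close>, the same
  holds for every \<open>a\<close> in \<open>M\<close>. Hence the lines and planes of \<open>M + p\<close> are spanned by lines and planes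
  of \<open>M\<close>, so \<open>M + p\<close> is again hypermodular and has fewer pairs of skew coplanar lines than \<open>M\<close>.
  Once there are no such pairs left, the matroid is modular.
\<close>

section \<open>Rank and flats\<close>

context finite_matroid
begin

lemma finite_indep: "I \<in> indep M \<Longrightarrow> finite I"
  using finite_ground indep_subset finite_subset by blast

lemma rk_eq_Max: "rk M X = Max (card ` {I \<in> indep M. I \<subseteq> X})"
  unfolding rk_def by (rule arg_cong[of _ _ Max]) auto

lemma finite_rk_cards: "finite (card ` {I \<in> indep M. I \<subseteq> X})"
proof -
  have "{I \<in> indep M. I \<subseteq> X} \<subseteq> Pow (ground M)"
    using indep_subset by auto
  then show ?thesis
    using finite_ground finite_subset by blast
qed

lemma card_le_rk: "I \<in> indep M \<Longrightarrow> I \<subseteq> X \<Longrightarrow> card I \<le> rk M X"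
  unfolding rk_eq_Max by (rule Max_ge[OF finite_rk_cards]) auto

lemma obtain_basis:
  obtains B where "B \<in> indep M" "B \<subseteq> X" "card B = rk M X"
proof -
  have "rk M X \<in> card ` {I \<in> indep M. I \<subseteq> X}"
    unfolding rk_eq_Max by (rule Max_in[OF finite_rk_cards]) (use indep_empty in auto)
  then show thesis using that by auto
qed

text \<open>A larger independent subset of \<open>X\<close> would, by augmentation, supply an
  element of \<open>X\<close> that enlarges \<open>I\<close>.\<close>

lemma rk_maximal_indep:
  assumes "I \<in> indep M" "I \<subseteq> X" "\<And>x. x \<in> X - I \<Longrightarrow> insert x I \<notin> indep M"
  shows "rk M X = card I"
proof -
  obtain B where B: "B \<in> indep M" "B \<subseteq> X" "card B = rk M X" by (rule obtain_basis)
  have "\<not> card I < card B"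
    using indep_augment[OF assms(1) B(1)] assms(3) B(2) by blast
  then show ?thesis
    using B(3) card_le_rk[OF assms(1,2)] by linarith
qed

lemma extend_basis:
  assumes "I \<in> indep M" "I \<subseteq> X"
  obtains B where "B \<in> indep M" "I \<subseteq> B" "B \<subseteq> X" "card B = rk M X"
proof -
  let ?F = "{J \<in> indep M. I \<subseteq> J \<and> J \<subseteq> X}"
  have "?F \<subseteq> Pow (ground M)" using indep_subset by auto
  then have "finite ?F" using finite_ground finite_subset by blast
  moreover have "I \<in> ?F" using assms by auto
  ultimately obtain B where B: "B \<in> ?F" "\<And>J. J \<in> ?F \<Longrightarrow> B \<subseteq> J \<Longrightarrow> B = J"
    using finite_has_maximal[of ?F] by (metis (no_types, lifting) empty_iff)
  have "rk M X = card B"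
    using B(1) B(2)[of "insert _ B"] by (intro rk_maximal_indep) blast+
  then show thesis using that B(1) by auto
qed

lemma rk_mono: "X \<subseteq> Y \<Longrightarrow> rk M X \<le> rk M Y"
  by (metis card_le_rk obtain_basis order_trans)

text \<open>A basis of \<open>X\<close> stays maximal in \<open>X \<union> Y\<close>: adding some
  \<open>y\<close> would give an independent subset of \<open>insert y X\<close> larger than
  \<open>rk M X\<close>.\<close>

lemma rk_absorb_Un:
  assumes "\<And>y. y \<in> Y \<Longrightarrow> rk M (insert y X) = rk M X"
  shows "rk M (X \<union> Y) = rk M X"
proof -
  obtain B where B: "B \<in> indep M" "B \<subseteq> X" "card B = rk M X" by (rule obtain_basis)
  have "insert y B \<notin> indep M" if y: "y \<in> X \<union> Y - B" for y
  proof
    assume "insert y B \<in> indep M"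
    then have "card (insert y B) \<le> rk M (insert y X)"
      using B(2) by (intro card_le_rk) auto
    moreover have "rk M (insert y X) = rk M X"
      using y assms by (cases "y \<in> X") (auto simp: insert_absorb)
    ultimately show False
      using y B(3) finite_indep[OF B(1)] by simp
  qed
  then show ?thesis
    using rk_maximal_indep[of B "X \<union> Y"] B by auto
qed

text \<open>A basis \<open>I\<close> of the intersection is extended to a basis \<open>B\<close> of
  the union. The traces of \<open>B\<close> on \<open>X\<close> and \<open>Y\<close> cover
  \<open>B\<close> and both contain \<open>I\<close>, so counting them gives the inequality.\<close>

lemma rk_submodular: "rk M (X \<union> Y) + rk M (X \<inter> Y) \<le> rk M X + rk M Y"
proof -
  obtain I where I: "I \<in> indep M" "I \<subseteq> X \<inter> Y" "card I = rk M (X \<inter> Y)"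
    by (rule obtain_basis)
  obtain B where B: "B \<in> indep M" "I \<subseteq> B" "B \<subseteq> X \<union> Y" "card B = rk M (X \<union> Y)"
    using extend_basis[of I "X \<union> Y"] I by blast
  have fin: "finite B" using B(1) finite_indep by blast
  have "card (B \<inter> X) + card (B \<inter> Y) = card (B \<inter> X \<union> B \<inter> Y) + card (B \<inter> X \<inter> (B \<inter> Y))"
    using fin by (intro card_Un_Int) auto
  moreover have "card (B \<inter> X \<union> B \<inter> Y) = card B"
    using B(3) by (intro arg_cong[of _ _ card]) auto
  moreover have "card I \<le> card (B \<inter> X \<inter> (B \<inter> Y))"
    using fin I(2) B(2) by (intro card_mono) auto
  moreover have "card (B \<inter> X) \<le> rk M X" "card (B \<inter> Y) \<le> rk M Y"
    using indep_hereditary[OF B(1)] by (auto intro!: card_le_rk)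
  ultimately show ?thesis using I(3) B(4) by linarith
qed

lemma rk_empty [simp]: "rk M {} = 0"
  using rk_maximal_indep[OF indep_empty, of "{}"] by simp

lemma rk_insert_le: "rk M (insert x X) \<le> Suc (rk M X)"
proof -
  obtain B where B: "B \<in> indep M" "B \<subseteq> insert x X" "card B = rk M (insert x X)"
    by (rule obtain_basis)
  have "card (B - {x}) \<le> rk M X"
    using indep_hereditary[OF B(1)] B(2) by (intro card_le_rk) auto
  then show ?thesis using B(3) finite_indep[OF B(1)] by (cases "x \<in> B") auto
qed

text \<open>Submodularity for \<open>insert x X\<close> and \<open>Y\<close>, which meet in
  \<open>X\<close> when \<open>x\<close> is outside \<open>Y\<close>. This is the main tool for the
  new element \<open>p\<close> later: once a line spans \<open>p\<close>, so does every set
  containing that line.\<close>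

lemma rk_insert_absorb_mono:
  assumes "rk M (insert x X) = rk M X" "X \<subseteq> Y"
  shows "rk M (insert x Y) = rk M Y"
proof (cases "x \<in> Y")
  case False
  have "rk M (insert x X \<union> Y) + rk M (insert x X \<inter> Y) \<le> rk M (insert x X) + rk M Y"
    by (rule rk_submodular)
  moreover have "insert x X \<union> Y = insert x Y" "insert x X \<inter> Y = X"
    using False assms(2) by auto
  ultimately show ?thesis
    using assms(1) rk_mono[of Y "insert x Y"] by (intro antisym) auto
qed (auto simp: insert_absorb)

section \<open>Closure and flats\<close>

definition cl :: "'a set \<Rightarrow> 'a set" where
  "cl X = {x \<in> ground M. rk M (insert x X) = rk M X}"

lemma cl_subset_ground: "cl X \<subseteq> ground M"
  by (auto simp: cl_def)

lemma subset_cl: "X \<subseteq> ground M \<Longrightarrow> X \<subseteq> cl X"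
  by (auto simp: cl_def insert_absorb)

lemma rk_cl:
  assumes "X \<subseteq> ground M"
  shows "rk M (cl X) = rk M X"
  using rk_absorb_Un[of "cl X" X] subset_cl[OF assms] by (simp add: cl_def sup_absorb2)

lemma cl_mono: "X \<subseteq> Y \<Longrightarrow> cl X \<subseteq> cl Y"
  using rk_insert_absorb_mono by (auto simp: cl_def)

lemma flat_subset_ground: "flat M A \<Longrightarrow> A \<subseteq> ground M"
  by (simp add: flat_def)

lemma flat_iff_cl: "flat M A \<longleftrightarrow> cl A = A"
proof -
  have "rk M A < rk M (insert x A) \<longleftrightarrow> rk M (insert x A) \<noteq> rk M A" for x
    using rk_mono[of A "insert x A"] by fastforce
  then show ?thesis
    unfolding flat_def cl_def by (auto simp: insert_absorb)
qed

lemma flat_cl: assumes "X \<subseteq> ground M" shows "flat M (cl X)"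
  unfolding flat_iff_cl
proof
  show "cl (cl X) \<subseteq> cl X"
  proof
    fix x assume x: "x \<in> cl (cl X)"
    have "rk M (insert x X) \<le> rk M (insert x (cl X))"
      using subset_cl[OF assms] by (intro rk_mono) auto
    also have "\<dots> = rk M X"
      using x rk_cl[OF assms] by (simp add: cl_def)
    finally show "x \<in> cl X"
      using x rk_mono[of X "insert x X"] by (simp add: cl_def antisym subset_insertI)
  qed
qed (use subset_cl[OF cl_subset_ground] in blast)

lemma cl_subset_flat: "flat M A \<Longrightarrow> X \<subseteq> A \<Longrightarrow> cl X \<subseteq> A"
  using cl_mono flat_iff_cl by blast

lemma flat_Int: "flat M A \<Longrightarrow> flat M B \<Longrightarrow> flat M (A \<inter> B)"
  using cl_subset_flat[of A "A \<inter> B"] cl_subset_flat[of B "A \<inter> B"]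
    subset_cl[of "A \<inter> B"] flat_subset_ground[of A] unfolding flat_iff_cl[of "A \<inter> B"]
  by (intro antisym) auto

lemma flat_ground: "flat M (ground M)"
  by (simp add: flat_def)

lemma in_flatI:
  assumes "flat M A" "x \<in> ground M" "rk M (insert x A) \<le> rk M A"
  shows "x \<in> A"
  using assms unfolding flat_def by (meson DiffI not_le)

lemma flat_eqI:
  assumes "flat M A" "A \<subseteq> X" "X \<subseteq> ground M" "rk M X \<le> rk M A"
  shows "A = X"
proof
  show "X \<subseteq> A"
  proof
    fix x assume "x \<in> X"
    then have "rk M (insert x A) \<le> rk M X" using assms(2) by (intro rk_mono) auto
    then show "x \<in> A"
      using in_flatI[OF assms(1)] \<open>x \<in> X\<close> assms(3,4) by auto
  qed
qed (rule assms)

lemma rk_insert_flat: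
  assumes "flat M A" "x \<in> ground M" "x \<notin> A"
  shows "rk M (insert x A) = Suc (rk M A)"
  using in_flatI[OF assms(1,2)] assms(3) rk_insert_le[of x A] by linarith

lemma flat_eq_cl:
  assumes "flat M A" "X \<subseteq> A" "rk M X = rk M A"
  shows "A = cl X"
proof (rule sym, rule flat_eqI)
  have X: "X \<subseteq> ground M" using assms(1,2) flat_subset_ground by blast
  show "flat M (cl X)" by (rule flat_cl[OF X])
  show "cl X \<subseteq> A" by (rule cl_subset_flat[OF assms(1,2)])
  show "A \<subseteq> ground M" by (rule flat_subset_ground[OF assms(1)])
  show "rk M A \<le> rk M (cl X)" using rk_cl[OF X] assms(3) by simp
qed

text \<open>If the union had the rank of \<open>A\<close>, each of the two flats would equal it by
  \<open>flat_eqI\<close>.\<close>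

lemma flats_neq_rk_Un:
  assumes "flat M A" "flat M B" "rk M A = rk M B" "A \<noteq> B"
  shows "rk M A < rk M (A \<union> B)"
proof (rule ccontr)
  assume *: "\<not> rk M A < rk M (A \<union> B)"
  have "A \<union> B \<subseteq> ground M" using assms(1,2) flat_subset_ground by blast
  then have "A = A \<union> B" "B = A \<union> B"
    using flat_eqI[OF assms(1), of "A \<union> B"] flat_eqI[OF assms(2), of "A \<union> B"] * assms(3) by auto
  then show False using assms(4) by simp
qed

lemma obtain_nonloop:
  assumes "0 < rk M X"
  obtains a where "a \<in> X" "a \<in> ground M" "rk M {a} = 1"
proof -
  obtain B where B: "B \<in> indep M" "B \<subseteq> X" "card B = rk M X" by (rule obtain_basis)
  then obtain a where a: "a \<in> B" using assms by fastforce
  then have "{a} \<in> indep M" using indep_hereditary[OF B(1)] by auto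
  then have "rk M {a} = 1" using card_le_rk[of "{a}" "{a}"] rk_insert_le[of a "{}"] by simp
  then show thesis using that a B indep_subset by blast
qed

end

section \<open>Hypermodular matroids of rank 4\<close>

lemma modular_pair_subset: "A \<subseteq> B \<Longrightarrow> modular_pair M A B"
  by (simp add: modular_pair_def Un_absorb1 Int_absorb2)

lemma modular_pair_commute: "modular_pair M A B \<longleftrightarrow> modular_pair M B A"
  by (simp add: modular_pair_def Un_commute Int_commute add.commute)

text \<open>The intersection has rank 0 instead of being empty because every flat contains all
  loops. By submodularity these are exactly the nonmodular pairs of lines. Their number is the
  measure of the induction in \<open>modular_extension\<close>.\<close>

definition skew_coplanar_lines :: "'a matroid \<Rightarrow> ('a set \<times> 'a set) set" where
  "skew_coplanar_lines M =
    {(A, B). flat M A \<and> flat M B \<and> rk M A = 2 \<and> rk M B = 2 \<and> rk M (A \<union> B) = 3 \<and> rk M (A \<inter> B) = 0}"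

locale hypermodular_rank4 = finite_matroid M for M :: "'a matroid" +
  assumes rk_ground: "rk M (ground M) = 4"
    and hypermodular: "hypermodular M"
begin

lemma rk_le_4: "X \<subseteq> ground M \<Longrightarrow> rk M X \<le> 4"
  using rk_mono[of X "ground M"] rk_ground by simp

text \<open>Distinct planes together have rank 4, so the modular equation leaves rank 3 + 3 - 4 for
  their intersection.\<close>

lemma planes_meet_in_line:
  assumes "flat M E" "flat M F" "rk M E = 3" "rk M F = 3" "E \<noteq> F"
  shows "rk M (E \<inter> F) = 2" "rk M (E \<union> F) = 4"
proof -
  have "3 < rk M (E \<union> F)"
    using flats_neq_rk_Un[of E F] assms by simp
  moreover have "rk M (E \<union> F) \<le> 4"
    using assms(1,2) flat_subset_ground by (intro rk_le_4) blast
  ultimately show "rk M (E \<union> F) = 4" by simp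
  moreover have "rk M (E \<union> F) + rk M (E \<inter> F) = rk M E + rk M F"
    using hypermodular assms rk_ground by (simp add: hypermodular_def modular_pair_def)
  ultimately show "rk M (E \<inter> F) = 2" using assms by simp
qed

lemma finite_skew_coplanar_lines: "finite (skew_coplanar_lines M)"
proof (rule finite_subset)
  show "skew_coplanar_lines M \<subseteq> Pow (ground M) \<times> Pow (ground M)"
    using flat_subset_ground by (auto simp: skew_coplanar_lines_def)
qed (use finite_ground in simp)

text \<open>The plane \<open>E\<close> through \<open>A\<close> and a point of \<open>B\<close>
  meets \<open>B\<close> in a line by hypermodularity. This line lies with \<open>A\<close> in
  \<open>E\<close> and meets \<open>A\<close> in rank 0. Thus a nonmodular line and plane yield a
  nonmodular pair of lines.\<close>

lemma line_plane_skew_imp_skew_lines: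
  assumes A: "flat M A" "rk M A = 2" and B: "flat M B" "rk M B = 3" and AB: "rk M (A \<inter> B) = 0"
  shows "skew_coplanar_lines M \<noteq> {}"
proof -
  have "\<not> B \<subseteq> A" using rk_mono[of B A] A B by auto
  then obtain x where x: "x \<in> B" "x \<notin> A" by blast
  have gr: "insert x A \<subseteq> ground M" using x A B flat_subset_ground by blast
  define E where "E = cl (insert x A)"
  have E: "flat M E" "rk M E = 3" "A \<subseteq> E"
    using flat_cl[OF gr] rk_cl[OF gr] subset_cl[OF gr] rk_insert_flat[of A x] A x gr
    by (auto simp: E_def)
  have "E \<noteq> B"
  proof
    assume "E = B"
    then have "A \<inter> B = A" using E(3) by auto
    then show False using AB A by simp
  qed
  then have L: "flat M (E \<inter> B)" "rk M (E \<inter> B) = 2"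
    using planes_meet_in_line[OF E(1) B(1) E(2) B(2)] flat_Int[OF E(1) B(1)] by auto
  have 0: "rk M (A \<inter> (E \<inter> B)) = 0"
    using rk_mono[of "A \<inter> (E \<inter> B)" "A \<inter> B"] AB by auto
  then have "A \<noteq> E \<inter> B" using A by auto
  then have "2 < rk M (A \<union> E \<inter> B)"
    using flats_neq_rk_Un[OF A(1) L(1)] A L by simp
  moreover have "rk M (A \<union> E \<inter> B) \<le> 3"
    using rk_mono[of "A \<union> E \<inter> B" E] E by auto
  ultimately have "(A, E \<inter> B) \<in> skew_coplanar_lines M"
    using A L 0 by (simp add: skew_coplanar_lines_def)
  then show ?thesis by blast
qed

text \<open>A nonmodular pair is incomparable, so
  \<open>rk M B < rk M (A \<union> B) \<le> 4\<close>. Together with strict submodularity this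
  forces the ranks to be 2 or 3, and the three cases fall to the definition of
  \<open>skew_coplanar_lines\<close>, to the preceding lemma and to hypermodularity.\<close>

lemma modular_pair_if_no_skew_lines:
  assumes none: "skew_coplanar_lines M = {}"
    and A: "flat M A" and B: "flat M B" and le: "rk M A \<le> rk M B"
  shows "modular_pair M A B"
proof (rule ccontr)
  assume non: "\<not> modular_pair M A B"
  then have sub: "\<not> A \<subseteq> B" "\<not> B \<subseteq> A"
    using modular_pair_subset modular_pair_commute by metis+
  then obtain x where x: "x \<in> A" "x \<notin> B" by blast
  have gA: "A \<subseteq> ground M" and gB: "B \<subseteq> ground M"
    using A B flat_subset_ground by auto
  have 1: "rk M (A \<union> B) + rk M (A \<inter> B) < rk M A + rk M B"
    using rk_submodular[of A B] non by (simp add: modular_pair_def)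
  have 2: "Suc (rk M B) \<le> rk M (A \<union> B)"
    using rk_insert_flat[of B x] rk_mono[of "insert x B" "A \<union> B"] x B gA by auto
  have 3: "rk M (A \<union> B) \<le> 4"
    using gA gB by (intro rk_le_4) simp
  consider "rk M A = 2" "rk M B = 2" | "rk M A = 2" "rk M B = 3" | "rk M A = 3" "rk M B = 3"
    using 1 2 3 le by linarith
  then show False
  proof cases
    case 1
    then have "(A, B) \<in> skew_coplanar_lines M"
      using \<open>rk M (A \<union> B) + rk M (A \<inter> B) < rk M A + rk M B\<close> 2 A B
      by (simp add: skew_coplanar_lines_def)
    then show False using none by simp
  next
    case 2
    then have "rk M (A \<inter> B) = 0"
      using 1 \<open>Suc (rk M B) \<le> rk M (A \<union> B)\<close> by simp
    then show False
      using line_plane_skew_imp_skew_lines[of A B] 2 A B none by simp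
  next
    case 3
    then show False
      using non hypermodular A B rk_ground by (simp add: hypermodular_def)
  qed
qed

lemma modular_if_no_skew_lines: "skew_coplanar_lines M = {} \<Longrightarrow> modular M"
  unfolding modular_def by (metis modular_pair_if_no_skew_lines modular_pair_commute nle_le)

end

section \<open>One-element extensions by a common point of two skew coplanar lines\<close>

locale single_extension = M: finite_matroid M + N: finite_matroid N
  for M N :: "'a matroid" and p :: 'a +
  assumes p_notin: "p \<notin> ground M"
    and ground_N: "ground N = insert p (ground M)"
    and indep_N_iff: "I \<subseteq> ground M \<Longrightarrow> I \<in> indep N \<longleftrightarrow> I \<in> indep M"
begin

lemma rk_N_eq: "X \<subseteq> ground M \<Longrightarrow> rk N X = rk M X"
  unfolding rk_def by (rule arg_cong[of _ _ Max]) (use indep_N_iff in blast)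

lemma restriction_N: "restriction N (ground M) = M"
proof -
  have "{I \<in> indep N. I \<subseteq> ground M} = indep M"
    using indep_N_iff M.indep_subset by blast
  then show ?thesis by (simp add: restriction_def)
qed

text \<open>An element of \<open>M\<close> spanned by the trace of \<open>F\<close> is spanned by
  \<open>F\<close> in \<open>N\<close>, hence lies in \<open>F\<close>.\<close>

lemma flat_N_Int_ground: assumes "flat N F" shows "flat M (F \<inter> ground M)"
  unfolding flat_def
proof (intro conjI ballI)
  fix x assume x: "x \<in> ground M - F \<inter> ground M"
  show "rk M (F \<inter> ground M) < rk M (insert x (F \<inter> ground M))"
  proof (rule ccontr)
    assume "\<not> ?thesis"
    then have "rk N (insert x (F \<inter> ground M)) \<le> rk N (F \<inter> ground M)"
      using x by (simp add: rk_N_eq)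
    then have "rk N (insert x (F \<inter> ground M)) = rk N (F \<inter> ground M)"
      using N.rk_mono[of "F \<inter> ground M" "insert x (F \<inter> ground M)"] by (intro antisym) auto
    then have "rk N (insert x F) = rk N F"
      by (rule N.rk_insert_absorb_mono) simp
    then have "x \<in> F" using N.in_flatI[OF assms, of x] x by (simp add: ground_N)
    then show False using x by simp
  qed
qed simp

end

text \<open>The element \<open>p\<close> lies in the span of both lines and is not a loop. These
  purely matroidal conditions are all that the representation has to provide; the lemmas of this
  locale argue with ranks alone.\<close>

locale skew_lines_extension = single_extension M N p + hypermodular_rank4 M
  for M N :: "'a matroid" and p :: 'a +
  fixes A B :: "'a set"
  assumes skew: "(A, B) \<in> skew_coplanar_lines M"
    and p_A: "rk N (insert p A) = rk N A"
    and p_B: "rk N (insert p B) = rk N B"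
    and p_nonloop: "0 < rk N {p}"
begin

lemma A: "flat M A" "rk M A = 2" "A \<subseteq> ground M"
  and B: "flat M B" "rk M B = 2" "B \<subseteq> ground M"
  and AB: "rk M (A \<union> B) = 3" "rk M (A \<inter> B) = 0"
  using skew M.flat_subset_ground by (auto simp: skew_coplanar_lines_def)

text \<open>Submodularity in \<open>N\<close> for \<open>insert p E\<close> and
  \<open>insert p F\<close>: both have rank 3 and their union has rank at least 4, so their
  intersection has rank at most 2. Since \<open>E \<inter> F\<close> already has rank 2, it spans
  \<open>p\<close>.\<close>

lemma planes_through_p:
  assumes "flat M E" "flat M F" "rk M E = 3" "rk M F = 3" "E \<noteq> F"
    and pE: "rk N (insert p E) = rk N E" and pF: "rk N (insert p F) = rk N F"
  shows "flat M (E \<inter> F) \<and> rk M (E \<inter> F) = 2 \<and> rk N (insert p (E \<inter> F)) = 2"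
proof -
  note EF = planes_meet_in_line[OF assms(1-5)]
  have g: "E \<subseteq> ground M" "F \<subseteq> ground M" using assms M.flat_subset_ground by auto
  then have rks: "rk N E = 3" "rk N F = 3" "rk N (E \<union> F) = 4" "rk N (E \<inter> F) = 2"
    using rk_N_eq[of E] rk_N_eq[of F] rk_N_eq[of "E \<union> F"] rk_N_eq[of "E \<inter> F"] assms(3,4) EF
    by (auto simp: le_infI1)
  have "rk N (insert p E \<union> insert p F) + rk N (insert p E \<inter> insert p F)
      \<le> rk N (insert p E) + rk N (insert p F)"
    by (rule N.rk_submodular)
  moreover have "rk N (insert p E \<inter> insert p F) = rk N (insert p (E \<inter> F))"
    by (rule arg_cong[of _ _ "rk N"]) auto
  moreover have "rk N (E \<union> F) \<le> rk N (insert p E \<union> insert p F)" by (rule N.rk_mono) auto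
  moreover have "rk N (E \<inter> F) \<le> rk N (insert p (E \<inter> F))" by (rule N.rk_mono) auto
  ultimately have "rk N (insert p (E \<inter> F)) = 2"
    using pE pF rks by linarith
  then show ?thesis
    using M.flat_Int[OF assms(1,2)] EF by simp
qed

lemma plane_spanned:
  assumes "flat M L" "rk M L = 2" "a \<in> ground M" "a \<notin> L" "rk N (insert p L) = rk N L"
  defines "E \<equiv> M.cl (insert a L)"
  shows "flat M E" "rk M E = 3" "L \<subseteq> E" "a \<in> E" "rk N (insert p E) = rk N E"
proof -
  have g: "insert a L \<subseteq> ground M" using assms M.flat_subset_ground by blast
  show "flat M E" using M.flat_cl[OF g] by (simp add: E_def)
  show "rk M E = 3"
    using M.rk_cl[OF g] M.rk_insert_flat[OF assms(1,3,4)] assms(2) by (simp add: E_def)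
  show "L \<subseteq> E" "a \<in> E" using M.subset_cl[OF g] by (auto simp: E_def)
  then show "rk N (insert p E) = rk N E"
    using N.rk_insert_absorb_mono[OF assms(5)] by simp
qed

text \<open>The planes joining \<open>a\<close> to \<open>A\<close> and to \<open>B\<close> both
  span \<open>p\<close>. They differ, since a common plane would contain \<open>A \<union> B\<close>
  and so equal \<open>M.cl (A \<union> B)\<close>, which misses \<open>a\<close>. Their intersection
  is the line.\<close>

lemma line_through_p_outside:
  assumes "a \<in> ground M" "a \<notin> M.cl (A \<union> B)"
  shows "\<exists>L. flat M L \<and> rk M L = 2 \<and> a \<in> L \<and> rk N (insert p L) = 2"
proof -
  have g: "A \<union> B \<subseteq> ground M" using A B by simp
  have aAB: "a \<notin> A" "a \<notin> B" using assms(2) M.subset_cl[OF g] by auto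
  note E = plane_spanned[OF A(1,2) assms(1) aAB(1) p_A]
  note F = plane_spanned[OF B(1,2) assms(1) aAB(2) p_B]
  have "M.cl (insert a A) \<noteq> M.cl (insert a B)"
  proof
    assume "M.cl (insert a A) = M.cl (insert a B)"
    then have "A \<union> B \<subseteq> M.cl (insert a A)" using E(3) F(3) by simp
    then have "M.cl (insert a A) = M.cl (A \<union> B)"
      using M.flat_eq_cl[OF E(1)] E(2) AB(1) by simp
    then show False using E(4) assms(2) by simp
  qed
  then show ?thesis
    using planes_through_p[OF E(1) F(1) E(2) F(2) _ E(5) F(5)] E(4) F(4) by blast
qed

text \<open>If \<open>a\<close> is in the plane \<open>E\<close> of \<open>A\<close> and
  \<open>B\<close>, an element \<open>x\<close> outside \<open>E\<close> has a line \<open>L\<close>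
  that spans \<open>p\<close>. The plane joining \<open>a\<close> to \<open>L\<close> contains
  \<open>x\<close>, so it differs from \<open>E\<close>, and both planes contain \<open>a\<close>
  and span \<open>p\<close>.\<close>

lemma line_through_p:
  assumes a: "a \<in> ground M"
  shows "\<exists>L. flat M L \<and> rk M L = 2 \<and> a \<in> L \<and> rk N (insert p L) = 2"
proof (cases "a \<in> M.cl (A \<union> B)")
  case False
  then show ?thesis by (rule line_through_p_outside[OF a])
next
  case True
  define E where "E = M.cl (A \<union> B)"
  have g: "A \<union> B \<subseteq> ground M" using A B by simp
  have E: "flat M E" "rk M E = 3" "A \<subseteq> E"
    using M.flat_cl[OF g] M.rk_cl[OF g] M.subset_cl[OF g] AB by (auto simp: E_def)
  have pE: "rk N (insert p E) = rk N E"
    by (rule N.rk_insert_absorb_mono[OF p_A E(3)])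
  have "\<not> ground M \<subseteq> E" using M.rk_mono[of "ground M" E] rk_ground E by auto
  then obtain x where x: "x \<in> ground M" "x \<notin> E" by blast
  then obtain L where L: "flat M L" "rk M L = 2" "x \<in> L" "rk N (insert p L) = 2"
    using line_through_p_outside by (auto simp: E_def)
  show ?thesis
  proof (cases "a \<in> L")
    case False
    have pL: "rk N (insert p L) = rk N L"
      using L rk_N_eq M.flat_subset_ground by simp
    note F = plane_spanned[OF L(1,2) a False pL]
    have "E \<noteq> M.cl (insert a L)" using F(3) L(3) x by auto
    then show ?thesis
      using planes_through_p[OF E(1) F(1) E(2) F(2) _ pE F(5)] F(4) True E_def by blast
  qed (use L in blast)
qed

text \<open>If \<open>a\<close> were parallel to \<open>p\<close>, it would lie in every flat of
  \<open>M\<close> that spans \<open>p\<close>, in particular in \<open>A \<inter> B\<close>, which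
  has rank 0.\<close>

lemma p_not_parallel:
  assumes a: "a \<in> ground M" "rk M {a} = 1"
  shows "2 \<le> rk N {a, p}"
proof (rule ccontr)
  assume "\<not> 2 \<le> rk N {a, p}"
  then have "rk N (insert a {p}) = rk N {p}"
    using N.rk_mono[of "{p}" "{a, p}"] p_nonloop by simp
  moreover have "a \<in> L" if L: "flat M L" "rk N (insert p L) = rk N L"
    and "rk N (insert a {p}) = rk N {p}" for L
  proof -
    have "L \<subseteq> ground M" using L M.flat_subset_ground by simp
    have "rk N (insert a (insert p L)) = rk N (insert p L)"
      using N.rk_insert_absorb_mono[OF that(3), of "insert p L"] by simp
    moreover have "rk N (insert a L) \<le> rk N (insert a (insert p L))"
      by (rule N.rk_mono) auto
    ultimately have "rk M (insert a L) \<le> rk M L"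
      using L rk_N_eq[of L] rk_N_eq[of "insert a L"] a \<open>L \<subseteq> ground M\<close> by simp
    then show ?thesis using M.in_flatI L a by blast
  qed
  ultimately have "a \<in> A \<inter> B" using A B p_A p_B by blast
  then show False using M.rk_mono[of "{a}" "A \<inter> B"] a AB by simp
qed

text \<open>The line \<open>L\<close> of \<open>M\<close> through \<open>a\<close> that spans
  \<open>p\<close> is spanned in \<open>N\<close> by \<open>a\<close> and \<open>p\<close>, because
  these two already have rank 2. A flat containing both therefore contains \<open>L\<close>.\<close>

lemma flat_through_p_contains_line:
  assumes F: "flat N F" "p \<in> F" "a \<in> F" and a: "a \<in> ground M" "rk M {a} = 1"
  shows "\<exists>L. flat M L \<and> rk M L = 2 \<and> L \<subseteq> F \<and> rk N (insert p L) = 2"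
proof -
  obtain L where L: "flat M L" "rk M L = 2" "a \<in> L" "rk N (insert p L) = 2"
    using line_through_p[OF a(1)] by blast
  have "y \<in> F" if y: "y \<in> L" for y
  proof -
    have "rk N (insert y {a, p}) \<le> rk N (insert p L)"
      using y L by (intro N.rk_mono) auto
    moreover have "rk N {a, p} \<le> rk N (insert y {a, p})" by (rule N.rk_mono) auto
    ultimately have "rk N (insert y {a, p}) = rk N {a, p}"
      using L(4) p_not_parallel[OF a] by linarith
    then have "rk N (insert y F) = rk N F"
      using N.rk_insert_absorb_mono[of y "{a, p}" F] F by simp
    moreover have "y \<in> ground N"
      using y L M.flat_subset_ground ground_N by blast
    ultimately show ?thesis using N.in_flatI[OF F(1)] by simp
  qed
  then show ?thesis using L by blast
qed

text \<open>A flat through \<open>p\<close> of rank at least 2 has a nonloop of \<open>M\<close>,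
  hence contains a line of \<open>M\<close> that spans \<open>p\<close>, and deleting
  \<open>p\<close> loses no rank. For rank 1 this fails at the point spanned by \<open>p\<close>,
  whose trace has rank 0.\<close>

lemma rk_flat_N_Int_ground:
  assumes F: "flat N F" "2 \<le> rk N F"
  shows "rk M (F \<inter> ground M) = rk N F"
proof (cases "p \<in> F")
  case False
  then have "F \<subseteq> ground M" using N.flat_subset_ground[OF F(1)] ground_N by auto
  then show ?thesis using rk_N_eq[of F] by (simp add: Int_absorb2)
next
  case True
  define G where "G = F \<inter> ground M"
  have FG: "F = insert p G"
    using N.flat_subset_ground[OF F(1)] ground_N True by (auto simp: G_def)
  have G: "rk N G = rk M G" by (rule rk_N_eq) (simp add: G_def)
  have "0 < rk M G"
    using N.rk_insert_le[of p G] FG F(2) G by simp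
  then obtain a where a: "a \<in> G" "a \<in> ground M" "rk M {a} = 1" by (rule M.obtain_nonloop)
  then obtain L where L: "flat M L" "rk M L = 2" "L \<subseteq> F" "rk N (insert p L) = 2"
    using flat_through_p_contains_line[OF F(1) True, of a] by (auto simp: G_def)
  have "L \<subseteq> ground M" using L M.flat_subset_ground by simp
  then have "rk N (insert p L) = rk N L" "L \<subseteq> G"
    using L rk_N_eq[of L] by (auto simp: G_def)
  then have "rk N (insert p G) = rk N G" by (rule N.rk_insert_absorb_mono)
  then show ?thesis by (simp only: G FG[symmetric] G_def[symmetric])
qed

lemma flat_N_eq_cl:
  assumes "flat N F" "2 \<le> rk N F"
  shows "F = N.cl (F \<inter> ground M)"
  using N.flat_eq_cl[of F "F \<inter> ground M"] rk_flat_N_Int_ground[OF assms] assms(1)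
    rk_N_eq[of "F \<inter> ground M"] by simp

lemma rk_ground_N: "rk N (ground N) = 4"
proof -
  have "4 \<le> rk N (ground N)"
    using rk_N_eq[of "ground M"] N.rk_mono[of "ground M" "ground N"] rk_ground ground_N by auto
  moreover have "ground N \<inter> ground M = ground M" using ground_N by auto
  ultimately show ?thesis
    using rk_flat_N_Int_ground[OF N.flat_ground] rk_ground by simp
qed

text \<open>Distinct planes of \<open>N\<close> have distinct planes of \<open>M\<close> as traces,
  since a plane is the closure of its trace. The traces meet in rank 2, so the planes of
  \<open>N\<close> meet in rank at least 2; submodularity gives the reverse bound.\<close>

lemma hypermodular_N: "hypermodular N"
proof -
  have "modular_pair N F F'"
    if F: "flat N F" "flat N F'" "rk N F = 3" "rk N F' = 3" for F F'
  proof (cases "F = F'")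
    case True
    then show ?thesis by (simp add: modular_pair_def)
  next
    case False
    define G G' where "G = F \<inter> ground M" and "G' = F' \<inter> ground M"
    have "G \<noteq> G'"
      using flat_N_eq_cl[of F] flat_N_eq_cl[of F'] F False by (auto simp: G_def G'_def)
    then have "rk M (G \<inter> G') = 2"
      using planes_meet_in_line[of G G'] flat_N_Int_ground rk_flat_N_Int_ground F
      by (simp add: G_def G'_def)
    moreover have "rk N (G \<inter> G') = rk M (G \<inter> G')"
      by (rule rk_N_eq) (auto simp: G_def)
    moreover have "rk N (G \<inter> G') \<le> rk N (F \<inter> F')"
      by (rule N.rk_mono) (auto simp: G_def G'_def)
    moreover have "3 < rk N (F \<union> F')"
      using N.flats_neq_rk_Un[OF F(1,2)] F(3,4) False by simp
    ultimately show ?thesis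
      using N.rk_submodular[of F F'] F by (simp add: modular_pair_def)
  qed
  then show ?thesis by (simp add: hypermodular_def rk_ground_N)
qed

lemma hypermodular_rank4_N: "hypermodular_rank4 N"
  by unfold_locales (rule rk_ground_N hypermodular_N)+

text \<open>Taking traces on \<open>ground M\<close> is an injection from the pairs of
  \<open>N\<close> into those of \<open>M\<close>, since a line of \<open>N\<close> is the closure
  of its trace. It misses \<open>(A, B)\<close>: lines of \<open>N\<close> with these traces would
  both contain the nonloop \<open>p\<close>.\<close>

lemma card_skew_coplanar_lines_less:
  "card (skew_coplanar_lines N) < card (skew_coplanar_lines M)"
proof -
  let ?g = "\<lambda>(F, F'). (F \<inter> ground M, F' \<inter> ground M)"
  have lines: "flat N F \<and> flat N F' \<and> rk N F = 2 \<and> rk N F' = 2 \<and> rk N (F \<union> F') = 3 \<and> rk N (F \<inter> F') = 0"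
    if "(F, F') \<in> skew_coplanar_lines N" for F F'
    using that by (simp add: skew_coplanar_lines_def)
  have inj: "inj_on ?g (skew_coplanar_lines N)"
  proof (rule inj_onI, clarify)
    fix F F' H H'
    assume "(F, F') \<in> skew_coplanar_lines N" "(H, H') \<in> skew_coplanar_lines N"
      and "F \<inter> ground M = H \<inter> ground M" "F' \<inter> ground M = H' \<inter> ground M"
    then show "F = H \<and> F' = H'"
      using flat_N_eq_cl[of F] flat_N_eq_cl[of F'] flat_N_eq_cl[of H] flat_N_eq_cl[of H']
        lines[of F F'] lines[of H H'] by simp
  qed
  have "?g ` skew_coplanar_lines N \<subseteq> skew_coplanar_lines M - {(A, B)}"
  proof (rule image_subsetI, clarify)
    fix F F' assume "(F, F') \<in> skew_coplanar_lines N"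
    note F = lines[OF this]
    define G G' where "G = F \<inter> ground M" and "G' = F' \<inter> ground M"
    have G: "flat M G" "flat M G'" "rk M G = 2" "rk M G' = 2"
      using F flat_N_Int_ground rk_flat_N_Int_ground by (auto simp: G_def G'_def)
    \<comment> \<open>The traces span the two lines, so \<open>G \<union> G'\<close> has the same
      rank as \<open>F \<union> F'\<close>, and coplanarity passes to the traces.\<close>
    have "rk N (insert y (G \<union> G')) = rk N (G \<union> G')" if "y \<in> F \<union> F'" for y
    proof -
      have "F = N.cl G" "F' = N.cl G'"
        using flat_N_eq_cl F by (auto simp: G_def G'_def)
      then have "y \<in> N.cl (G \<union> G')"
        using that N.cl_mono[of G "G \<union> G'"] N.cl_mono[of G' "G \<union> G'"] by auto
      then show ?thesis by (simp add: N.cl_def)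
    qed
    then have "rk N (G \<union> G' \<union> (F \<union> F')) = rk N (G \<union> G')" by (rule N.rk_absorb_Un)
    moreover have "G \<union> G' \<union> (F \<union> F') = F \<union> F'" by (auto simp: G_def G'_def)
    moreover have "rk N (G \<union> G') = rk M (G \<union> G')"
      by (rule rk_N_eq) (auto simp: G_def G'_def)
    ultimately have un: "rk M (G \<union> G') = 3" using F by simp
    have "rk M (G \<inter> G') = rk N (G \<inter> G')"
      by (rule rk_N_eq[symmetric]) (auto simp: G_def)
    also have "\<dots> \<le> rk N (F \<inter> F')" by (rule N.rk_mono) (auto simp: G_def G'_def)
    finally have int: "rk M (G \<inter> G') = 0" using F by simp
    have "(G, G') \<noteq> (A, B)"
    proof
      assume "(G, G') = (A, B)"
      then have "A \<subseteq> F" "B \<subseteq> F'" by (auto simp: G_def G'_def)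
      then have "rk N (insert p F) = rk N F" "rk N (insert p F') = rk N F'"
        using N.rk_insert_absorb_mono p_A p_B by auto
      then have "p \<in> F \<inter> F'"
        using N.in_flatI[of _ p] F ground_N by simp
      then show False
        using N.rk_mono[of "{p}" "F \<inter> F'"] F p_nonloop by simp
    qed
    then show "(F \<inter> ground M, F' \<inter> ground M) \<in> skew_coplanar_lines M - {(A, B)}"
      using G un int by (simp add: skew_coplanar_lines_def G_def G'_def)
  qed
  then have "?g ` skew_coplanar_lines N \<subset> skew_coplanar_lines M" using skew by blast
  then have "card (?g ` skew_coplanar_lines N) < card (skew_coplanar_lines M)"
    by (rule psubset_card_mono[OF finite_skew_coplanar_lines])
  then show ?thesis using inj by (simp add: card_image)
qed

end

section \<open>Vector families over a field\<close>

lemma (in ring) finsum_swap: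
  assumes "finite A" "finite B" "\<And>x y. x \<in> A \<Longrightarrow> y \<in> B \<Longrightarrow> f x y \<in> carrier R"
  shows "(\<Oplus>x\<in>A. \<Oplus>y\<in>B. f x y) = (\<Oplus>y\<in>B. \<Oplus>x\<in>A. f x y)"
  using assms(1,3)
proof (induction A rule: finite_induct)
  case empty
  then show ?case by (simp add: finsum_zero)
next
  case (insert a A)
  have "(\<Oplus>x\<in>insert a A. \<Oplus>y\<in>B. f x y) = (\<Oplus>y\<in>B. f a y) \<oplus> (\<Oplus>x\<in>A. \<Oplus>y\<in>B. f x y)"
    using insert by (intro finsum_insert) (auto intro!: finsum_closed)
  also have "\<dots> = (\<Oplus>y\<in>B. f a y) \<oplus> (\<Oplus>y\<in>B. \<Oplus>x\<in>A. f x y)"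
    using insert by simp
  also have "\<dots> = (\<Oplus>y\<in>B. f a y \<oplus> (\<Oplus>x\<in>A. f x y))"
    using insert by (intro finsum_addf[symmetric]) (auto intro!: finsum_closed)
  also have "\<dots> = (\<Oplus>y\<in>B. \<Oplus>x\<in>insert a A. f x y)"
    using insert by (intro finsum_cong') (auto intro!: finsum_closed finsum_insert[symmetric])
  finally show ?case .
qed

context field
begin

lemma homogeneous_system_nontrivial:
  assumes "finite I" "finite J" "card I < card J"
    and "\<And>x i. x \<in> J \<Longrightarrow> i \<in> I \<Longrightarrow> a x i \<in> carrier R"
  shows "\<exists>c\<in>J \<rightarrow> carrier R. (\<exists>x\<in>J. c x \<noteq> \<zero>) \<and> (\<forall>i\<in>I. (\<Oplus>x\<in>J. c x \<otimes> a x i) = \<zero>)"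
  using assms
proof (induction I arbitrary: J a rule: finite_induct)
  case empty
  then have "J \<noteq> {}" by auto
  then show ?case by (intro bexI[of _ "\<lambda>_. \<one>"]) auto
next
  case (insert k I)
  show ?case
  proof (cases "\<forall>x\<in>J. a x k = \<zero>")
    case True
    have "\<exists>c\<in>J \<rightarrow> carrier R. (\<exists>x\<in>J. c x \<noteq> \<zero>) \<and> (\<forall>i\<in>I. (\<Oplus>x\<in>J. c x \<otimes> a x i) = \<zero>)"
      using insert.prems insert.hyps by (intro insert.IH) auto
    then obtain c where c: "c \<in> J \<rightarrow> carrier R" "\<exists>x\<in>J. c x \<noteq> \<zero>"
      "\<And>i. i \<in> I \<Longrightarrow> (\<Oplus>x\<in>J. c x \<otimes> a x i) = \<zero>" by blast
    have "(\<Oplus>x\<in>J. c x \<otimes> a x k) = (\<Oplus>x\<in>J. \<zero>)"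
      using True c(1) by (intro finsum_cong') (auto simp: Pi_iff)
    then show ?thesis using c by (intro bexI[of _ c]) (auto simp: finsum_zero)
  next
    case False
    then obtain z where z: "z \<in> J" "a z k \<noteq> \<zero>" by blast
    have zk: "a z k \<in> carrier R" using insert.prems(3) z by simp
    define q where "q = inv (a z k)"
    have q: "q \<in> carrier R" "q \<otimes> a z k = \<one>"
      using zk z field_Units by (auto simp: q_def)
    define J' where "J' = J - {z}"
    have J': "finite J'" "z \<notin> J'" "J = insert z J'" using z insert.prems(1) by (auto simp: J'_def)
    have aJ: "a x i \<in> carrier R" if "x \<in> J'" "i \<in> insert k I" for x i
      using insert.prems(3) that J' by auto
    have az: "a z i \<in> carrier R" if "i \<in> insert k I" for i
      using insert.prems(3) that z by auto
    \<comment> \<open>A multiple of the pivot vector \<open>a z\<close> is subtracted from each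
      \<open>a x\<close> to clear its coordinate \<open>k\<close>.\<close>
    define b where "b x i = a x i \<ominus> (a x k \<otimes> q) \<otimes> a z i" for x i
    have "\<exists>c\<in>J' \<rightarrow> carrier R. (\<exists>x\<in>J'. c x \<noteq> \<zero>) \<and> (\<forall>i\<in>I. (\<Oplus>x\<in>J'. c x \<otimes> b x i) = \<zero>)"
      using insert.prems insert.hyps aJ az q J'(1) z
      by (intro insert.IH) (auto simp: b_def J'_def)
    then obtain c where c: "c \<in> J' \<rightarrow> carrier R" "\<exists>x\<in>J'. c x \<noteq> \<zero>"
      and c0: "\<And>i. i \<in> I \<Longrightarrow> (\<Oplus>x\<in>J'. c x \<otimes> b x i) = \<zero>" by blast
    have cJ: "c x \<in> carrier R" if "x \<in> J'" for x using c(1) that by blast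
    \<comment> \<open>The coefficient \<open>\<ominus> s\<close> at \<open>z\<close> collects all
      the multiples of \<open>a z\<close> subtracted in \<open>b\<close>, so \<open>d\<close>
      combines the vectors \<open>a x\<close> to the same result as \<open>c\<close> combines the
      vectors \<open>b x\<close>.\<close>
    define s where "s = (\<Oplus>x\<in>J'. c x \<otimes> (a x k \<otimes> q))"
    have s: "s \<in> carrier R" using cJ aJ q by (auto simp: s_def intro!: finsum_closed)
    define d where "d = c(z := \<ominus> s)"
    have dsum: "(\<Oplus>x\<in>J. d x \<otimes> a x i) = (\<Oplus>x\<in>J'. c x \<otimes> b x i)" if i: "i \<in> insert k I" for i
    proof -
      have "(\<Oplus>x\<in>J. d x \<otimes> a x i) = d z \<otimes> a z i \<oplus> (\<Oplus>x\<in>J'. d x \<otimes> a x i)"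
        unfolding J'(3) using J' cJ aJ[OF _ i] az[OF i] s
        by (intro finsum_insert) (auto simp: d_def)
      also have "(\<Oplus>x\<in>J'. d x \<otimes> a x i) = (\<Oplus>x\<in>J'. c x \<otimes> a x i)"
        using J' cJ aJ[OF _ i] by (intro finsum_cong') (auto simp: d_def)
      also have "d z \<otimes> a z i = (\<Oplus>x\<in>J'. c x \<otimes> (a x k \<otimes> q)) \<otimes> (\<ominus> a z i)"
        using s az[OF i] by (simp add: d_def s_def[symmetric] l_minus r_minus)
      also have "\<dots> = (\<Oplus>x\<in>J'. c x \<otimes> (a x k \<otimes> q) \<otimes> (\<ominus> a z i))"
        using J' cJ aJ q az[OF i] by (intro finsum_ldistr) auto
      also have "\<dots> \<oplus> (\<Oplus>x\<in>J'. c x \<otimes> a x i)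
          = (\<Oplus>x\<in>J'. c x \<otimes> (a x k \<otimes> q) \<otimes> (\<ominus> a z i) \<oplus> c x \<otimes> a x i)"
        using J' cJ aJ i q az[OF i] by (intro finsum_addf[symmetric]) auto
      also have "\<dots> = (\<Oplus>x\<in>J'. c x \<otimes> b x i)"
      proof (intro finsum_cong')
        fix x assume x: "x \<in> J'"
        then have "c x \<in> carrier R" "a x k \<in> carrier R" "a x i \<in> carrier R"
          using cJ aJ i by auto
        then show "c x \<otimes> (a x k \<otimes> q) \<otimes> (\<ominus> a z i) \<oplus> c x \<otimes> a x i = c x \<otimes> b x i"
          using q(1) az[OF i] unfolding b_def
          by (simp add: minus_eq r_distr r_minus m_assoc a_comm)
      qed (use cJ aJ i q az in \<open>auto simp: b_def\<close>)
      finally show ?thesis .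
    qed
    have "b x k = \<zero>" if "x \<in> J'" for x
    proof -
      have ax: "a x k \<in> carrier R" using aJ that by simp
      have "(a x k \<otimes> q) \<otimes> a z k = a x k \<otimes> (q \<otimes> a z k)"
        using ax q(1) zk by (intro m_assoc)
      then show ?thesis using ax q by (simp add: b_def r_neg minus_eq)
    qed
    then have "(\<Oplus>x\<in>J'. c x \<otimes> b x k) = (\<Oplus>x\<in>J'. \<zero>)"
      using cJ by (intro finsum_cong') auto
    then have "(\<Oplus>x\<in>J'. c x \<otimes> b x k) = \<zero>" by (simp add: finsum_zero)
    then have "\<forall>i\<in>insert k I. (\<Oplus>x\<in>J. d x \<otimes> a x i) = \<zero>"
      using dsum c0 by auto
    moreover have "d \<in> J \<rightarrow> carrier R" using cJ s by (auto simp: d_def J'_def)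
    moreover have "\<exists>x\<in>J. d x \<noteq> \<zero>" using c(2) J' by (auto simp: d_def)
    ultimately show ?thesis by blast
  qed
qed

lemma finsum_coeff_extend:
  assumes "finite S" "T \<subseteq> S" "c \<in> T \<rightarrow> carrier R" "\<And>e. e \<in> S \<Longrightarrow> v e i \<in> carrier R"
  shows "(\<Oplus>e\<in>S. (if e \<in> T then c e else \<zero>) \<otimes> v e i) = (\<Oplus>e\<in>T. c e \<otimes> v e i)"
  using assms by (intro add.finprod_mono_neutral_cong_right) (auto simp: Pi_def subset_iff)

end

text \<open>\<^const>\<open>lin_indep_family\<close> only accepts plain \<open>ring\<close> records, hence this instance of \<open>field\<close>.\<close>

locale scalar_field = field R for R :: "'a ring" (structure)
begin

section \<open>Spans and linear independence\<close>

definition in_span :: "nat \<Rightarrow> ('b \<Rightarrow> nat \<Rightarrow> 'a) \<Rightarrow> (nat \<Rightarrow> 'a) \<Rightarrow> 'b set \<Rightarrow> bool" where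
  "in_span n v w S \<longleftrightarrow> (\<exists>c\<in>S \<rightarrow> carrier R. \<forall>i<n. w i = (\<Oplus>e\<in>S. c e \<otimes> v e i))"

lemma lin_indep_familyD:
  assumes "lin_indep_family R n v S" "c \<in> S \<rightarrow> carrier R"
    and "\<And>i. i < n \<Longrightarrow> (\<Oplus>e\<in>S. c e \<otimes> v e i) = \<zero>" "e \<in> S"
  shows "c e = \<zero>"
  using assms unfolding lin_indep_family_def by blast

lemma lin_indep_family_subset:
  assumes S: "lin_indep_family R n v S" and fin: "finite S" and T: "T \<subseteq> S"
    and v: "\<And>e i. e \<in> S \<Longrightarrow> i < n \<Longrightarrow> v e i \<in> carrier R"
  shows "lin_indep_family R n v T"
  unfolding lin_indep_family_def
proof (intro ballI impI)
  fix c e assume c: "c \<in> T \<rightarrow> carrier R" and 0: "\<forall>i<n. (\<Oplus>e\<in>T. c e \<otimes> v e i) = \<zero>" and e: "e \<in> T"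
  have "(if e \<in> T then c e else \<zero>) = \<zero>"
  proof (rule lin_indep_familyD[OF S])
    fix i assume i: "i < n"
    show "(\<Oplus>e\<in>S. (if e \<in> T then c e else \<zero>) \<otimes> v e i) = \<zero>"
      using finsum_coeff_extend[OF fin T c, of v i] v i 0 by simp
  qed (use c e T in auto)
  then show "c e = \<zero>" using e by simp
qed

lemma in_span_self:
  assumes "finite S" "x \<in> S" "\<And>e i. e \<in> S \<Longrightarrow> i < n \<Longrightarrow> v e i \<in> carrier R"
  shows "in_span n v (v x) S"
  unfolding in_span_def
proof (intro bexI allI impI)
  fix i assume i: "i < n"
  have "(\<Oplus>e\<in>S. (if e \<in> {x} then \<one> else \<zero>) \<otimes> v e i) = (\<Oplus>e\<in>{x}. \<one> \<otimes> v e i)"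
    using assms i by (intro finsum_coeff_extend) auto
  also have "\<dots> = v x i" using assms i by (simp add: finsum_insert)
  finally show "v x i = (\<Oplus>e\<in>S. (if e \<in> {x} then \<one> else \<zero>) \<otimes> v e i)" by simp
qed auto

text \<open>A nontrivial relation on \<open>insert x S\<close> has a nonzero coefficient at
  \<open>x\<close>, since otherwise it would be a relation on \<open>S\<close>. Dividing by it and
  changing sign expresses \<open>v x\<close>.\<close>

lemma dependent_insert_imp_in_span:
  assumes S: "lin_indep_family R n v S" and fin: "finite S" and x: "x \<notin> S"
    and v: "\<And>e i. e \<in> insert x S \<Longrightarrow> i < n \<Longrightarrow> v e i \<in> carrier R"
    and dep: "\<not> lin_indep_family R n v (insert x S)"
  shows "in_span n v (v x) S"
proof -
  obtain c where c: "c \<in> insert x S \<rightarrow> carrier R"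
    and 0: "\<And>i. i < n \<Longrightarrow> (\<Oplus>e\<in>insert x S. c e \<otimes> v e i) = \<zero>"
    and nz: "\<exists>e\<in>insert x S. c e \<noteq> \<zero>"
    using dep unfolding lin_indep_family_def by blast
  have cc: "c e \<in> carrier R" if "e \<in> insert x S" for e using c that by blast
  have split: "c x \<otimes> v x i \<oplus> (\<Oplus>e\<in>S. c e \<otimes> v e i) = \<zero>" if i: "i < n" for i
    using 0[OF i] finsum_insert[of S x "\<lambda>e. c e \<otimes> v e i"] fin x cc v[OF _ i] by auto
  have cx: "c x \<noteq> \<zero>"
  proof
    assume x0: "c x = \<zero>"
    have "(\<Oplus>e\<in>S. c e \<otimes> v e i) = \<zero>" if i: "i < n" for i
    proof -
      have "(\<Oplus>e\<in>S. c e \<otimes> v e i) \<in> carrier R" using cc v[OF _ i] by (auto intro!: finsum_closed)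
      then show ?thesis using split[OF i] x0 v[OF _ i] by simp
    qed
    then have "c e = \<zero>" if "e \<in> S" for e
      using lin_indep_familyD[OF S, of c] c that by blast
    then show False using nz x0 by auto
  qed
  define q where "q = \<ominus> (inv (c x))"
  have iv: "inv (c x) \<in> carrier R" "inv (c x) \<otimes> c x = \<one>" using cx cc field_Units by auto
  then have q: "q \<in> carrier R" by (simp add: q_def)
  have "v x i = (\<Oplus>e\<in>S. (q \<otimes> c e) \<otimes> v e i)" if i: "i < n" for i
  proof -
    let ?s = "\<Oplus>e\<in>S. c e \<otimes> v e i"
    have s: "?s \<in> carrier R" using cc v[OF _ i] by (auto intro!: finsum_closed)
    have vx: "v x i \<in> carrier R" using v[OF _ i] by simp
    have "c x \<otimes> v x i = \<ominus> ?s"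
      using split[OF i] s vx cc by (intro minus_equality[symmetric]) auto
    then have "inv (c x) \<otimes> (c x \<otimes> v x i) = q \<otimes> ?s"
      using iv s by (simp add: q_def l_minus r_minus)
    moreover have "inv (c x) \<otimes> (c x \<otimes> v x i) = v x i"
      using iv vx cc by (simp add: m_assoc[symmetric])
    moreover have "q \<otimes> ?s = (\<Oplus>e\<in>S. q \<otimes> (c e \<otimes> v e i))"
      using fin q cc v[OF _ i] by (intro finsum_rdistr) auto
    moreover have "\<dots> = (\<Oplus>e\<in>S. (q \<otimes> c e) \<otimes> v e i)"
      using q cc v[OF _ i] by (intro finsum_cong') (auto simp: m_assoc)
    ultimately show ?thesis by simp
  qed
  then show ?thesis
    unfolding in_span_def using q cc by (intro bexI[of _ "\<lambda>e. q \<otimes> c e"]) auto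
qed

lemma in_span_imp_dependent:
  assumes fin: "finite S" and x: "x \<notin> S"
    and v: "\<And>e i. e \<in> insert x S \<Longrightarrow> i < n \<Longrightarrow> v e i \<in> carrier R"
    and span: "in_span n v (v x) S"
  shows "\<not> lin_indep_family R n v (insert x S)"
proof
  assume ind: "lin_indep_family R n v (insert x S)"
  obtain c where c: "c \<in> S \<rightarrow> carrier R" "\<And>i. i < n \<Longrightarrow> v x i = (\<Oplus>e\<in>S. c e \<otimes> v e i)"
    using span unfolding in_span_def by blast
  \<comment> \<open>Moving \<open>v x\<close> to the other side gives a relation with the
    coefficient \<open>\<ominus> \<one>\<close> at \<open>x\<close>, which is not zero.\<close>
  define d where "d = c(x := \<ominus> \<one>)"
  have "d x = \<zero>"
  proof (rule lin_indep_familyD[OF ind])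
    fix i assume i: "i < n"
    have "(\<Oplus>e\<in>insert x S. d e \<otimes> v e i) = d x \<otimes> v x i \<oplus> (\<Oplus>e\<in>S. d e \<otimes> v e i)"
      using fin x c(1) v[OF _ i] by (intro finsum_insert) (auto simp: d_def Pi_iff)
    also have "(\<Oplus>e\<in>S. d e \<otimes> v e i) = (\<Oplus>e\<in>S. c e \<otimes> v e i)"
      using x c(1) v[OF _ i] by (intro finsum_cong') (auto simp: d_def)
    also have "\<dots> = v x i" using c(2)[OF i] by simp
    finally show "(\<Oplus>e\<in>insert x S. d e \<otimes> v e i) = \<zero>"
      using v[OF _ i] by (simp add: d_def l_minus l_neg)
  qed (use c(1) in \<open>auto simp: d_def\<close>)
  then show False by (simp add: d_def)
qed

text \<open>If no element of \<open>J\<close> could be added, every \<open>v x\<close> with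
  \<open>x\<close> in \<open>J\<close> would be a combination of the family \<open>I\<close>, with
  coefficients \<open>a x\<close>. As \<open>card I < card J\<close>, some nonzero \<open>c\<close>
  annihilates all these coefficients at once, and exchanging the sums turns \<open>c\<close> into a
  relation on \<open>J\<close>.\<close>

lemma lin_indep_family_augment:
  assumes I: "lin_indep_family R n v I" and J: "lin_indep_family R n v J"
    and fin: "finite I" "finite J" and card: "card I < card J"
    and v: "\<And>e i. e \<in> I \<union> J \<Longrightarrow> i < n \<Longrightarrow> v e i \<in> carrier R"
  shows "\<exists>x\<in>J - I. lin_indep_family R n v (insert x I)"
proof (rule ccontr)
  assume *: "\<not> ?thesis"
  have "in_span n v (v x) I" if x: "x \<in> J" for x
  proof (cases "x \<in> I")
    case True
    then show ?thesis using in_span_self[OF fin(1) True] v by simp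
  next
    case False
    then show ?thesis
      using * x v by (intro dependent_insert_imp_in_span[OF I fin(1)]) auto
  qed
  then have "\<forall>x\<in>J. \<exists>a. a \<in> I \<rightarrow> carrier R \<and> (\<forall>i<n. v x i = (\<Oplus>e\<in>I. a e \<otimes> v e i))"
    unfolding in_span_def by blast
  then obtain a where a: "\<And>x e. x \<in> J \<Longrightarrow> e \<in> I \<Longrightarrow> a x e \<in> carrier R"
    and va: "\<And>x i. x \<in> J \<Longrightarrow> i < n \<Longrightarrow> v x i = (\<Oplus>e\<in>I. a x e \<otimes> v e i)"
    unfolding bchoice_iff Pi_def by blast
  obtain c where c: "c \<in> J \<rightarrow> carrier R" "\<exists>x\<in>J. c x \<noteq> \<zero>"
    and c0: "\<And>e. e \<in> I \<Longrightarrow> (\<Oplus>x\<in>J. c x \<otimes> a x e) = \<zero>"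
    using homogeneous_system_nontrivial[OF fin card, of a] a by blast
  have cc: "c x \<in> carrier R" if "x \<in> J" for x using c that by blast
  have "(\<Oplus>x\<in>J. c x \<otimes> v x i) = \<zero>" if i: "i < n" for i
  proof -
    have vi: "v e i \<in> carrier R" if "e \<in> I \<union> J" for e using v[OF that i] .
    have "(\<Oplus>x\<in>J. c x \<otimes> v x i) = (\<Oplus>x\<in>J. \<Oplus>e\<in>I. c x \<otimes> (a x e \<otimes> v e i))"
    proof (intro finsum_cong' refl)
      fix x assume x: "x \<in> J"
      have "c x \<otimes> v x i = c x \<otimes> (\<Oplus>e\<in>I. a x e \<otimes> v e i)" using va[OF x i] by simp
      also have "\<dots> = (\<Oplus>e\<in>I. c x \<otimes> (a x e \<otimes> v e i))"
        using fin x cc a vi by (intro finsum_rdistr) auto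
      finally show "c x \<otimes> v x i = (\<Oplus>e\<in>I. c x \<otimes> (a x e \<otimes> v e i))" .
    qed (use cc a vi in \<open>auto intro!: finsum_closed\<close>)
    also have "\<dots> = (\<Oplus>e\<in>I. \<Oplus>x\<in>J. c x \<otimes> (a x e \<otimes> v e i))"
      using fin cc a vi by (intro finsum_swap) auto
    also have "\<dots> = (\<Oplus>e\<in>I. \<zero>)"
    proof (intro finsum_cong' refl)
      fix e assume e: "e \<in> I"
      have "(\<Oplus>x\<in>J. c x \<otimes> (a x e \<otimes> v e i)) = (\<Oplus>x\<in>J. c x \<otimes> a x e \<otimes> v e i)"
        using cc a e vi by (intro finsum_cong') (auto simp: m_assoc)
      also have "\<dots> = (\<Oplus>x\<in>J. c x \<otimes> a x e) \<otimes> v e i"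
        using fin cc a e vi by (intro finsum_ldistr[symmetric]) auto
      finally show "(\<Oplus>x\<in>J. c x \<otimes> (a x e \<otimes> v e i)) = \<zero>"
        using c0[OF e] vi e by simp
    qed auto
    finally show ?thesis by (simp add: finsum_zero)
  qed
  then show False
    using lin_indep_familyD[OF J, of c] c by blast
qed

section \<open>Vector matroids and common vectors of two spans\<close>

definition vector_matroid :: "nat \<Rightarrow> ('b \<Rightarrow> nat \<Rightarrow> 'a) \<Rightarrow> 'b set \<Rightarrow> 'b matroid" where
  "vector_matroid n v E = \<lparr>ground = E, indep = {S. S \<subseteq> E \<and> lin_indep_family R n v S}\<rparr>"

lemma finite_matroid_vector_matroid:
  assumes E: "finite E" and v: "\<And>e i. e \<in> E \<Longrightarrow> i < n \<Longrightarrow> v e i \<in> carrier R"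
  shows "finite_matroid (vector_matroid n v E)"
proof
  fix I J :: "'b set"
  show "finite (ground (vector_matroid n v E))" "{} \<in> indep (vector_matroid n v E)"
    using E by (auto simp: vector_matroid_def lin_indep_family_def)
  assume I: "I \<in> indep (vector_matroid n v E)"
  then have I': "I \<subseteq> E" "finite I" "lin_indep_family R n v I"
    using E finite_subset by (auto simp: vector_matroid_def)
  then show "I \<subseteq> ground (vector_matroid n v E)" by (simp add: vector_matroid_def)
  show "J \<in> indep (vector_matroid n v E)" if "J \<subseteq> I"
    using lin_indep_family_subset[OF I'(3,2) that] that I' v by (auto simp: vector_matroid_def)
  assume "J \<in> indep (vector_matroid n v E)" and card: "card I < card J"
  then have J': "J \<subseteq> E" "finite J" "lin_indep_family R n v J"
    using E finite_subset by (auto simp: vector_matroid_def)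
  have "\<exists>x\<in>J - I. lin_indep_family R n v (insert x I)"
    using I' J' v by (intro lin_indep_family_augment[OF I'(3) J'(3) I'(2) J'(2) card]) blast
  then show "\<exists>x\<in>J - I. insert x I \<in> indep (vector_matroid n v E)"
    using I' J' by (auto simp: vector_matroid_def)
qed

lemma lin_indep_family_cong:
  assumes "\<And>e i. e \<in> S \<Longrightarrow> i < n \<Longrightarrow> v e i = v' e i"
    and "\<And>e i. e \<in> S \<Longrightarrow> i < n \<Longrightarrow> v' e i \<in> carrier R"
  shows "lin_indep_family R n v S \<longleftrightarrow> lin_indep_family R n v' S"
proof -
  have "(\<Oplus>e\<in>S. d e \<otimes> v e i) = (\<Oplus>e\<in>S. d e \<otimes> v' e i)"
    if "i < n" "d \<in> S \<rightarrow> carrier R" for d i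
    using that assms by (intro finsum_cong') (auto simp: Pi_iff)
  then show ?thesis unfolding lin_indep_family_def by simp
qed

text \<open>A nontrivial relation on \<open>X \<union> Y\<close> is split into its part on
  \<open>X\<close>, which is \<open>w\<close>, and its part on \<open>Y - X\<close>, which is
  \<open>\<ominus> w\<close>. If \<open>w\<close> were in the span of \<open>I\<close>, uniqueness
  of coefficients on \<open>X\<close> would confine the relation to \<open>Y\<close>, where it must
  be trivial.\<close>

lemma common_vector_of_spans:
  assumes fin: "finite X" "finite Y" and I: "I \<subseteq> X \<inter> Y"
    and v: "\<And>e i. e \<in> X \<union> Y \<Longrightarrow> i < n \<Longrightarrow> v e i \<in> carrier R"
    and X: "lin_indep_family R n v X" and Y: "lin_indep_family R n v Y"
    and dep: "\<not> lin_indep_family R n v (X \<union> Y)"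
  shows "\<exists>w. (\<forall>i<n. w i \<in> carrier R) \<and> in_span n v w X \<and> in_span n v w Y \<and> \<not> in_span n v w I"
proof -
  obtain c where c: "c \<in> X \<union> Y \<rightarrow> carrier R"
    and 0: "\<And>i. i < n \<Longrightarrow> (\<Oplus>e\<in>X \<union> Y. c e \<otimes> v e i) = \<zero>"
    and nz: "\<exists>e\<in>X \<union> Y. c e \<noteq> \<zero>"
    using dep unfolding lin_indep_family_def by blast
  have cc: "c e \<in> carrier R" if "e \<in> X \<union> Y" for e using c that by blast
  define w where "w i = (\<Oplus>e\<in>X. c e \<otimes> v e i)" for i
  have w: "w i \<in> carrier R" if "i < n" for i
    using cc v that by (auto simp: w_def intro!: finsum_closed)
  have "in_span n v w X"
    unfolding in_span_def w_def using cc by (intro bexI[of _ c]) auto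
  moreover have "in_span n v w Y"
    unfolding in_span_def
  proof (intro bexI allI impI)
    let ?d = "\<lambda>e. if e \<in> Y - X then \<ominus> c e else \<zero>"
    fix i assume i: "i < n"
    have ve: "v e i \<in> carrier R" if "e \<in> X \<union> Y" for e using v[OF that i] .
    let ?s = "\<Oplus>e\<in>Y - X. c e \<otimes> v e i"
    have s: "?s \<in> carrier R" using cc ve by (auto intro!: finsum_closed)
    have "(\<Oplus>e\<in>X \<union> (Y - X). c e \<otimes> v e i) = w i \<oplus> ?s"
      unfolding w_def using fin cc ve by (intro finsum_Un_disjoint) auto
    then have "w i \<oplus> ?s = \<zero>" using 0[OF i] by simp
    then have "w i = \<ominus> ?s" using w[OF i] s by (intro minus_equality[symmetric])
    also have "\<dots> = (\<ominus> \<one>) \<otimes> ?s" using s by (simp add: l_minus)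
    also have "\<dots> = (\<Oplus>e\<in>Y - X. (\<ominus> \<one>) \<otimes> (c e \<otimes> v e i))"
      using fin cc ve by (intro finsum_rdistr) auto
    also have "\<dots> = (\<Oplus>e\<in>Y - X. \<ominus> c e \<otimes> v e i)"
      using cc ve by (intro finsum_cong') (auto simp: l_minus)
    also have "\<dots> = (\<Oplus>e\<in>Y. ?d e \<otimes> v e i)"
      using fin cc ve by (intro finsum_coeff_extend[symmetric]) auto
    finally show "w i = (\<Oplus>e\<in>Y. ?d e \<otimes> v e i)" .
  next
    show "(\<lambda>e. if e \<in> Y - X then \<ominus> c e else \<zero>) \<in> Y \<rightarrow> carrier R" using cc by auto
  qed
  moreover have "\<not> in_span n v w I"
  proof
    assume "in_span n v w I"
    then obtain d where d: "d \<in> I \<rightarrow> carrier R" "\<And>i. i < n \<Longrightarrow> w i = (\<Oplus>e\<in>I. d e \<otimes> v e i)"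
      unfolding in_span_def by blast
    let ?d = "\<lambda>e. if e \<in> I then d e else \<zero>"
    have dc: "?d e \<in> carrier R" for e using d(1) by auto
    have eq: "c e = ?d e" if e: "e \<in> X" for e
    proof -
      have "c e \<ominus> ?d e = \<zero>"
      proof (rule lin_indep_familyD[OF X _ _ e])
        show "(\<lambda>e. c e \<ominus> ?d e) \<in> X \<rightarrow> carrier R" using cc dc by (auto intro!: minus_closed)
        fix i assume i: "i < n"
        have ve: "v e i \<in> carrier R" if "e \<in> X \<union> Y" for e using v[OF that i] .
        \<comment> \<open>Adding the combination of the differences to \<open>w i\<close>, written
          with the coefficients \<open>?d\<close>, returns \<open>w i\<close> written with the
          coefficients \<open>c\<close>; cancelling \<open>w i\<close> leaves zero.\<close>
        have "w i \<oplus> (\<Oplus>e\<in>X. (c e \<ominus> ?d e) \<otimes> v e i) = (\<Oplus>e\<in>X. ?d e \<otimes> v e i) \<oplus> (\<Oplus>e\<in>X. (c e \<ominus> ?d e) \<otimes> v e i)"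
          using d I fin ve i finsum_coeff_extend[of X I d v i] by auto
        also have "\<dots> = (\<Oplus>e\<in>X. ?d e \<otimes> v e i \<oplus> (c e \<ominus> ?d e) \<otimes> v e i)"
          using cc dc ve by (intro finsum_addf[symmetric]) (auto intro!: minus_closed)
        also have "\<dots> = w i"
          unfolding w_def
        proof (intro finsum_cong' refl)
          fix e assume "e \<in> X"
          then have ce: "c e \<in> carrier R" "v e i \<in> carrier R" using cc ve by auto
          have "?d e \<otimes> v e i \<oplus> (c e \<ominus> ?d e) \<otimes> v e i = (?d e \<oplus> (c e \<ominus> ?d e)) \<otimes> v e i"
            using ce dc[of e] by (intro l_distr[symmetric] minus_closed)
          also have "?d e \<oplus> (c e \<ominus> ?d e) = c e"
            unfolding minus_eq a_comm[OF ce(1) a_inv_closed[OF dc]] by (rule r_neg2[OF dc ce(1)])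
          finally show "?d e \<otimes> v e i \<oplus> (c e \<ominus> ?d e) \<otimes> v e i = c e \<otimes> v e i" .
        qed (use cc ve in auto)
        finally have *: "w i \<oplus> (\<Oplus>e\<in>X. (c e \<ominus> ?d e) \<otimes> v e i) = w i" .
        have "(\<Oplus>e\<in>X. (c e \<ominus> ?d e) \<otimes> v e i) \<in> carrier R"
          using cc dc ve by (auto intro!: finsum_closed minus_closed)
        then show "(\<Oplus>e\<in>X. (c e \<ominus> ?d e) \<otimes> v e i) = \<zero>"
          using * w[OF i] add.r_cancel_one by simp
      qed
      then show ?thesis using cc dc e r_right_minus_eq by blast
    qed
    have "c e = \<zero>" if e: "e \<in> Y" for e
    proof (rule lin_indep_familyD[OF Y _ _ e])
      show "c \<in> Y \<rightarrow> carrier R" using c by auto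
      fix i assume i: "i < n"
      have ve: "v e i \<in> carrier R" if "e \<in> X \<union> Y" for e using v[OF that i] .
      \<comment> \<open>As \<open>I\<close> lies in \<open>Y\<close>, an element outside
        \<open>Y\<close> is outside \<open>I\<close>, where \<open>?d\<close> is zero by
        default.\<close>
      have "c e \<otimes> v e i = \<zero>" if "e \<in> X \<union> Y - Y" for e
        using eq[of e] that I ve by auto
      then have "(\<Oplus>e\<in>X \<union> Y. c e \<otimes> v e i) = (\<Oplus>e\<in>Y. c e \<otimes> v e i)"
        using fin cc ve by (intro add.finprod_mono_neutral_cong_right) auto
      then show "(\<Oplus>e\<in>Y. c e \<otimes> v e i) = \<zero>" using 0[OF i] by simp
    qed
    moreover from this have "c e = \<zero>" if "e \<in> X" for e
      using eq[OF that] I by (cases "e \<in> I") auto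
    ultimately show False using nz by blast
  qed
  ultimately show ?thesis using w by blast
qed

text \<open>Bases \<open>X\<close> of \<open>A\<close> and \<open>Y\<close> of \<open>B\<close> that
  extend one basis \<open>I\<close> of \<open>A \<inter> B\<close> are jointly dependent. This gives
  a vector \<open>w\<close> in both spans but outside the span of \<open>I\<close>, and
  \<open>p\<close> is represented by \<open>w\<close>.\<close>

lemma representable_extension_by_intersection:
  assumes M: "finite_matroid M" and rep: "representable_over R M"
    and A: "A \<subseteq> ground M" and B: "B \<subseteq> ground M"
    and AB: "rk M (A \<union> B) + rk M (A \<inter> B) < rk M A + rk M B"
    and p: "p \<notin> ground M"
  shows "\<exists>N. single_extension M N p \<and> representable_over R N \<and>
    rk N (insert p A) = rk N A \<and> rk N (insert p B) = rk N B \<and>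
    rk N (A \<inter> B) < rk N (insert p (A \<inter> B))"
proof -
  interpret M: finite_matroid M by (rule M)
  obtain n v where v: "\<And>e i. e \<in> ground M \<Longrightarrow> i < n \<Longrightarrow> v e i \<in> carrier R"
    and ind: "\<And>S. S \<subseteq> ground M \<Longrightarrow> S \<in> indep M \<longleftrightarrow> lin_indep_family R n v S"
    using rep unfolding representable_over_def by blast
  obtain I where I: "I \<in> indep M" "I \<subseteq> A \<inter> B" "card I = rk M (A \<inter> B)"
    by (rule M.obtain_basis)
  obtain X where X: "X \<in> indep M" "I \<subseteq> X" "X \<subseteq> A" "card X = rk M A"
    using M.extend_basis[of I A] I by blast
  obtain Y where Y: "Y \<in> indep M" "I \<subseteq> Y" "Y \<subseteq> B" "card Y = rk M B"
    using M.extend_basis[of I B] I by blast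
  have fin: "finite X" "finite Y" "finite I" using X Y I M.finite_indep by auto
  have XY: "X \<union> Y \<subseteq> ground M" using X Y A B by blast
  \<comment> \<open>Otherwise \<open>card X + card Y\<close>, which is
    \<open>card (X \<union> Y) + card (X \<inter> Y)\<close>, would be at most
    \<open>rk M (A \<union> B) + rk M (A \<inter> B)\<close>, against \<open>AB\<close>.\<close>
  have "X \<union> Y \<notin> indep M"
  proof
    assume "X \<union> Y \<in> indep M"
    then have "card (X \<union> Y) \<le> rk M (A \<union> B)"
      using X Y by (intro M.card_le_rk) auto
    moreover have "card (X \<inter> Y) \<le> rk M (A \<inter> B)"
      using X Y M.indep_hereditary[OF X(1)] by (intro M.card_le_rk) auto
    ultimately show False
      using card_Un_Int[OF fin(1,2)] X(4) Y(4) AB by linarith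
  qed
  then have dep: "\<not> lin_indep_family R n v (X \<union> Y)" using ind[OF XY] by simp
  have indXY: "lin_indep_family R n v X" "lin_indep_family R n v Y"
    using ind[of X] ind[of Y] X(1) Y(1) XY by auto
  have vXY: "v e i \<in> carrier R" if "e \<in> X \<union> Y" "i < n" for e i
    using v that XY by blast
  obtain w where w: "\<And>i. i < n \<Longrightarrow> w i \<in> carrier R"
    and wX: "in_span n v w X" and wY: "in_span n v w Y" and wI: "\<not> in_span n v w I"
    using common_vector_of_spans[OF fin(1,2) Int_greatest[OF X(2) Y(2)] vXY indXY dep] by blast
  define v' where "v' = v(p := w)"
  define N where "N = vector_matroid n v' (insert p (ground M))"
  have v': "v' e i \<in> carrier R" if "e \<in> insert p (ground M)" "i < n" for e i
    using that v w by (auto simp: v'_def)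
  interpret N: finite_matroid N
    unfolding N_def using M.finite_ground v' by (intro finite_matroid_vector_matroid) auto
  have N_iff: "S \<in> indep N \<longleftrightarrow> lin_indep_family R n v' S" if "S \<subseteq> insert p (ground M)" for S
    using that by (simp add: N_def vector_matroid_def)
  have NM: "S \<in> indep N \<longleftrightarrow> S \<in> indep M" if S: "S \<subseteq> ground M" for S
  proof -
    have "lin_indep_family R n v' S \<longleftrightarrow> lin_indep_family R n v S"
      using S p v by (intro lin_indep_family_cong) (auto simp: v'_def)
    then show ?thesis using S N_iff ind by auto
  qed
  interpret ext: single_extension M N p
    using p NM by unfold_locales (auto simp: N_def vector_matroid_def)
  have rep_N: "representable_over R N"
    unfolding representable_over_def using v' N_iff
    by (intro exI[of _ n] exI[of _ v']) (auto simp: ext.ground_N)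
  have span_iff: "in_span n v' (v' p) S \<longleftrightarrow> in_span n v w S" if S: "S \<subseteq> ground M" for S
  proof -
    have "(\<Oplus>e\<in>S. d e \<otimes> v' e i) = (\<Oplus>e\<in>S. d e \<otimes> v e i)" if "i < n" "d \<in> S \<rightarrow> carrier R" for d i
      using that S p v by (intro finsum_cong') (auto simp: v'_def Pi_iff subset_iff)
    then show ?thesis unfolding in_span_def by (auto simp: v'_def)
  qed
  \<comment> \<open>The basis \<open>Z\<close> of \<open>C\<close> stays maximal in
    \<open>insert p C\<close>: the vector of \<open>p\<close> is in its span, and every other
    candidate comes from \<open>C\<close>.\<close>
  have spanned: "rk N (insert p C) = rk N C"
    if Z: "Z \<in> indep M" "Z \<subseteq> C" "card Z = rk M C" "in_span n v w Z" and C: "C \<subseteq> ground M" for Z C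
  proof -
    have Z': "Z \<subseteq> ground M" "finite Z" "p \<notin> Z" using Z C p M.finite_indep by auto
    have "rk N (insert p C) = card Z"
    proof (rule N.rk_maximal_indep)
      show "Z \<in> indep N" using Z Z' NM by simp
      show "Z \<subseteq> insert p C" using Z by auto
      fix x assume x: "x \<in> insert p C - Z"
      show "insert x Z \<notin> indep N"
      proof (cases "x = p")
        case True
        have "\<not> lin_indep_family R n v' (insert p Z)"
          using Z Z' v' span_iff by (intro in_span_imp_dependent) auto
        then show ?thesis using True N_iff[of "insert p Z"] Z' by auto
      next
        case False
        then have "insert x Z \<subseteq> C" using x Z by auto
        moreover have "card (insert x Z) = Suc (rk M C)" using x Z Z' by simp
        ultimately have "insert x Z \<notin> indep M"
          using M.card_le_rk[of "insert x Z" C] by auto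
        then show ?thesis using NM[of "insert x Z"] \<open>insert x Z \<subseteq> C\<close> C by blast
      qed
    qed
    then show ?thesis using Z ext.rk_N_eq[OF C] by simp
  qed
  have "insert p I \<in> indep N"
  proof (rule ccontr)
    assume "insert p I \<notin> indep N"
    moreover have I': "I \<subseteq> ground M" using I A by blast
    moreover have "lin_indep_family R n v' I"
      using I I' NM N_iff[of I] by auto
    ultimately have "in_span n v' (v' p) I"
      using fin p v' N_iff[of "insert p I"]
      by (intro dependent_insert_imp_in_span) auto
    then show False using wI span_iff[OF I'] by simp
  qed
  moreover have "insert p I \<subseteq> insert p (A \<inter> B)" using I(2) by (rule insert_mono)
  ultimately have "card (insert p I) \<le> rk N (insert p (A \<inter> B))" by (rule N.card_le_rk)
  moreover have "p \<notin> I" using I(2) A p by blast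
  moreover have "rk N (A \<inter> B) = rk M (A \<inter> B)" by (rule ext.rk_N_eq) (use A in blast)
  ultimately have "rk N (A \<inter> B) < rk N (insert p (A \<inter> B))"
    using I(3) fin(3) by simp
  then show ?thesis
    using ext.single_extension_axioms rep_N spanned[OF X(1,3,4) wX A] spanned[OF Y(1,3,4) wY B]
    by blast
qed

end

section \<open>Descent to a countable field\<close>

text \<open>A countable syntax with one constructor for each closure rule of
  \<open>generate_field\<close>; \<open>Gen k\<close> stands for the generator numbered
  \<open>k\<close>.\<close>

datatype field_term = Gen nat | One | Neg field_term | Inv field_term
  | Add field_term field_term | Mult field_term field_term

instance field_term :: countable
  by countable_datatype

primrec eval_field_term :: "('a, 'b) ring_scheme \<Rightarrow> (nat \<Rightarrow> 'a) \<Rightarrow> field_term \<Rightarrow> 'a" where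
  "eval_field_term R g (Gen k) = g k"
| "eval_field_term R g One = \<one>\<^bsub>R\<^esub>"
| "eval_field_term R g (Neg s) = \<ominus>\<^bsub>R\<^esub> eval_field_term R g s"
| "eval_field_term R g (Inv s) = inv\<^bsub>R\<^esub> eval_field_term R g s"
| "eval_field_term R g (Add s t) = eval_field_term R g s \<oplus>\<^bsub>R\<^esub> eval_field_term R g t"
| "eval_field_term R g (Mult s t) = eval_field_term R g s \<otimes>\<^bsub>R\<^esub> eval_field_term R g t"

text \<open>By induction every generated element is the value of a term, and there are countably
  many terms. Inclusion in the range suffices: \<open>Inv\<close> is evaluated at zero as well, so
  further values may occur.\<close>

lemma countable_generate_field:
  assumes "countable H"
  shows "countable (generate_field R H)"
proof -
  let ?eval = "eval_field_term R (from_nat_into H)"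
  have "x \<in> range ?eval" if "x \<in> generate_field R H" for x
    using that
  proof induction
    case one
    have "\<one>\<^bsub>R\<^esub> = ?eval One" by simp
    then show ?case by blast
  next
    case (incl h)
    then have "h = ?eval (Gen (to_nat_on H h))" using assms by simp
    then show ?case by blast
  next
    case (a_inv h)
    then obtain s where "h = ?eval s" by blast
    then have "\<ominus>\<^bsub>R\<^esub> h = ?eval (Neg s)" by simp
    then show ?case by blast
  next
    case (m_inv h)
    then obtain s where "h = ?eval s" by blast
    then have "inv\<^bsub>R\<^esub> h = ?eval (Inv s)" by simp
    then show ?case by blast
  next
    case (eng_add h1 h2)
    then obtain s t where "h1 = ?eval s" "h2 = ?eval t" by blast
    then have "h1 \<oplus>\<^bsub>R\<^esub> h2 = ?eval (Add s t)" by simp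
    then show ?case by blast
  next
    case (eng_mult h1 h2)
    then obtain s t where "h1 = ?eval s" "h2 = ?eval t" by blast
    then have "h1 \<otimes>\<^bsub>R\<^esub> h2 = ?eval (Mult s t)" by simp
    then show ?case by blast
  qed
  then show ?thesis by (meson countableI_type countable_image countable_subset subsetI)
qed

text \<open>The subfield generated by \<open>H\<close> is countable, so its structure can be carried
  along an injection \<open>f\<close> into the natural numbers. The map \<open>g\<close> is the
  inverse of \<open>f\<close>, read as a map into \<open>R\<close>.\<close>

lemma (in field) countable_subfield_copy:
  assumes "countable H" "H \<subseteq> carrier R"
  shows "\<exists>(L :: nat ring) g. field L \<and> g \<in> ring_hom L R \<and> inj_on g (carrier L) \<and> H \<subseteq> g ` carrier L"
proof -
  define F where "F = generate_field R H"
  define K where "K = R\<lparr>carrier := F\<rparr>"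
  define f where "f = to_nat_on F"
  define L where "L = image_ring f K"
  have F: "F \<subseteq> carrier R" "H \<subseteq> F"
    using generate_field_incl[OF assms(2)] by (auto simp: F_def intro: generate_field.incl)
  interpret K: field K
    unfolding K_def F_def by (rule generate_field_is_field[OF assms(2)])
  have inj: "inj_on f (carrier K)"
    using inj_on_to_nat_on[OF countable_generate_field[OF assms(1)]]
    by (simp add: K_def F_def f_def)
  have iso: "f \<in> ring_iso K L"
    unfolding L_def by (rule inj_imp_image_ring_iso[OF inj])
  have L: "field L"
    unfolding L_def by (rule K.inj_imp_image_ring_is_field[OF inj])
  define g where "g = inv_into (carrier K) f"
  have g: "g \<in> ring_iso L K"
    unfolding g_def by (rule ring_iso_set_sym[OF K.ring_axioms iso])
  then have "g \<in> ring_hom L R" "inj_on g (carrier L)" "g ` carrier L = F"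
    using F(1) by (auto simp: ring_iso_def ring_hom_def K_def bij_betw_def)
  then show ?thesis using L F(2) by blast
qed

section \<open>Transfer of a representation to the countable field\<close>

context scalar_field
begin

text \<open>The embedding \<open>g\<close> commutes with sums and reflects zero, so relations over
  \<open>L\<close> become relations over \<open>R\<close>. For the other direction a dependence over
  \<open>R\<close> must have coefficients in the image of \<open>g\<close>, and
  \<open>coeffs\<close> supplies such a one.\<close>

lemma lin_indep_family_hom:
  assumes L: "field L" and g: "g \<in> ring_hom L R" "inj_on g (carrier L)"
    and S: "finite S" and u: "\<And>e i. e \<in> S \<Longrightarrow> i < n \<Longrightarrow> u e i \<in> carrier L"
    and coeffs: "\<not> lin_indep_family R n (\<lambda>e i. g (u e i)) S \<Longrightarrow>
      \<exists>c\<in>S \<rightarrow> carrier L. (\<forall>i<n. (\<Oplus>e\<in>S. g (c e) \<otimes> g (u e i)) = \<zero>) \<and> (\<exists>e\<in>S. g (c e) \<noteq> \<zero>)"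
  shows "lin_indep_family L n u S \<longleftrightarrow> lin_indep_family R n (\<lambda>e i. g (u e i)) S"
proof -
  interpret L: field L by (rule L)
  interpret g: ring_hom_cring L R g
    by (intro ring_hom_cring.intro L.cring_axioms cring_axioms ring_hom_cring_axioms.intro g(1))
  have sum: "g (\<Oplus>\<^bsub>L\<^esub>e\<in>S. c e \<otimes>\<^bsub>L\<^esub> u e i) = (\<Oplus>e\<in>S. g (c e) \<otimes> g (u e i))"
    if c: "c \<in> S \<rightarrow> carrier L" and i: "i < n" for c i
  proof -
    have cS: "c e \<in> carrier L" if "e \<in> S" for e using c that by blast
    have "g (\<Oplus>\<^bsub>L\<^esub>e\<in>S. c e \<otimes>\<^bsub>L\<^esub> u e i) = (\<Oplus>e\<in>S. (g \<circ> (\<lambda>e. c e \<otimes>\<^bsub>L\<^esub> u e i)) e)"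
      using cS u i by (intro g.hom_finsum) auto
    also have "\<dots> = (\<Oplus>e\<in>S. g (c e) \<otimes> g (u e i))"
      using cS u i by (intro finsum_cong') auto
    finally show ?thesis .
  qed
  have zero_iff: "g x = \<zero> \<longleftrightarrow> x = \<zero>\<^bsub>L\<^esub>" if "x \<in> carrier L" for x
    using inj_onD[OF g(2), of x "\<zero>\<^bsub>L\<^esub>"] that by auto
  have closed: "(\<Oplus>\<^bsub>L\<^esub>e\<in>S. c e \<otimes>\<^bsub>L\<^esub> u e i) \<in> carrier L" if "c \<in> S \<rightarrow> carrier L" "i < n" for c i
    using that u by (auto intro!: L.finsum_closed)
  show ?thesis
  proof
    assume *: "lin_indep_family L n u S"
    show "lin_indep_family R n (\<lambda>e i. g (u e i)) S"
    proof (rule ccontr)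
      assume "\<not> ?thesis"
      then obtain c where c: "c \<in> S \<rightarrow> carrier L"
        "\<And>i. i < n \<Longrightarrow> (\<Oplus>e\<in>S. g (c e) \<otimes> g (u e i)) = \<zero>" "\<exists>e\<in>S. g (c e) \<noteq> \<zero>"
        using coeffs by blast
      have "(\<Oplus>\<^bsub>L\<^esub>e\<in>S. c e \<otimes>\<^bsub>L\<^esub> u e i) = \<zero>\<^bsub>L\<^esub>" if "i < n" for i
        using sum[OF c(1) that] c(2)[OF that] zero_iff[OF closed[OF c(1) that]] by simp
      then have "\<forall>e\<in>S. c e = \<zero>\<^bsub>L\<^esub>"
        using * c(1) unfolding lin_indep_family_def by blast
      then show False using c(3) by auto
    qed
  next
    assume *: "lin_indep_family R n (\<lambda>e i. g (u e i)) S"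
    show "lin_indep_family L n u S"
      unfolding lin_indep_family_def
    proof (intro ballI impI)
      fix c e assume c: "c \<in> S \<rightarrow> carrier L"
        and 0: "\<forall>i<n. (\<Oplus>\<^bsub>L\<^esub>e\<in>S. c e \<otimes>\<^bsub>L\<^esub> u e i) = \<zero>\<^bsub>L\<^esub>" and e: "e \<in> S"
      have "g (c e) = \<zero>"
        using sum[OF c] 0 c e by (intro lin_indep_familyD[OF *, of "\<lambda>e. g (c e)"]) auto
      then show "c e = \<zero>\<^bsub>L\<^esub>" using zero_iff[of "c e"] c e by blast
    qed
  qed
qed

text \<open>Finitely many field elements determine which sets are dependent, so a countable subfield
  containing them is enough. The matrix \<open>u\<close> over its copy \<open>L\<close> is
  \<open>v\<close> pulled back along \<open>g\<close>.\<close>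

lemma representable_over_imp_realizable_nat:
  assumes fin: "finite (ground M)" and rep: "representable_over R M"
  shows "realizable TYPE(nat) M"
proof -
  obtain n v where v: "\<And>e i. e \<in> ground M \<Longrightarrow> i < n \<Longrightarrow> v e i \<in> carrier R"
    and ind: "\<And>S. S \<subseteq> ground M \<Longrightarrow> S \<in> indep M \<longleftrightarrow> lin_indep_family R n v S"
    using rep unfolding representable_over_def by blast
  define dep where "dep = {S. S \<subseteq> ground M \<and> \<not> lin_indep_family R n v S}"
  have "\<forall>S\<in>dep. \<exists>c. c \<in> S \<rightarrow> carrier R \<and> (\<forall>i<n. (\<Oplus>e\<in>S. c e \<otimes> v e i) = \<zero>) \<and> (\<exists>e\<in>S. c e \<noteq> \<zero>)"
    unfolding dep_def lin_indep_family_def by blast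
  then obtain c where c: "\<And>S. S \<in> dep \<Longrightarrow> c S \<in> S \<rightarrow> carrier R"
    and c0: "\<And>S i. S \<in> dep \<Longrightarrow> i < n \<Longrightarrow> (\<Oplus>e\<in>S. c S e \<otimes> v e i) = \<zero>"
    and cn: "\<And>S. S \<in> dep \<Longrightarrow> \<exists>e\<in>S. c S e \<noteq> \<zero>"
    unfolding bchoice_iff by blast
  \<comment> \<open>Adjoining the coefficients of one relation for each dependent set keeps these sets
    dependent over the subfield.\<close>
  define H where "H = (\<Union>e\<in>ground M. \<Union>i\<in>{..<n}. {v e i}) \<union> (\<Union>S\<in>dep. c S ` S)"
  have "finite dep" "\<And>S. S \<in> dep \<Longrightarrow> finite S"
    using fin finite_subset by (auto simp: dep_def)
  then have "countable H" using fin by (auto simp: H_def intro!: countable_finite)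
  moreover have "H \<subseteq> carrier R" using v c by (auto simp: H_def)
  ultimately obtain L :: "nat ring" and g where L: "field L" "g \<in> ring_hom L R"
    "inj_on g (carrier L)" "H \<subseteq> g ` carrier L"
    using countable_subfield_copy by blast
  define h where "h = inv_into (carrier L) g"
  have h: "h x \<in> carrier L" "g (h x) = x" if "x \<in> H" for x
    using that L(4) by (auto simp: h_def inv_into_into f_inv_into_f subset_iff)
  define u where "u e i = h (v e i)" for e i
  have vH: "v e i \<in> H" if "e \<in> ground M" "i < n" for e i using that by (auto simp: H_def)
  have "lin_indep_family L n u S \<longleftrightarrow> lin_indep_family R n v S" if S: "S \<subseteq> ground M" for S
  proof -
    have eq: "lin_indep_family R n (\<lambda>e i. g (u e i)) S \<longleftrightarrow> lin_indep_family R n v S"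
    proof -
      have "(\<Oplus>e\<in>S. d e \<otimes> g (u e i)) = (\<Oplus>e\<in>S. d e \<otimes> v e i)"
        if "i < n" "d \<in> S \<rightarrow> carrier R" for d i
        using that S v vH h(2) by (intro finsum_cong') (auto simp: u_def Pi_iff subset_iff)
      then show ?thesis unfolding lin_indep_family_def by simp
    qed
    have "lin_indep_family L n u S \<longleftrightarrow> lin_indep_family R n (\<lambda>e i. g (u e i)) S"
    proof (rule lin_indep_family_hom[OF L(1,2,3)])
      show "finite S" using S fin finite_subset by blast
      show "u e i \<in> carrier L" if "e \<in> S" "i < n" for e i
        using that S vH h(1) by (auto simp: u_def)
      assume "\<not> lin_indep_family R n (\<lambda>e i. g (u e i)) S"
      then have d: "S \<in> dep" using eq S by (simp add: dep_def)
      then have cH: "c S e \<in> H" if "e \<in> S" for e using that by (auto simp: H_def)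
      have "(\<Oplus>e\<in>S. g (h (c S e)) \<otimes> g (u e i)) = \<zero>" if i: "i < n" for i
      proof -
        have "(\<Oplus>e\<in>S. g (h (c S e)) \<otimes> g (u e i)) = (\<Oplus>e\<in>S. c S e \<otimes> v e i)"
          using i S v vH h(2) cH c[OF d] by (intro finsum_cong') (auto simp: u_def Pi_iff subset_iff)
        then show ?thesis using c0[OF d i] by simp
      qed
      then show "\<exists>c\<in>S \<rightarrow> carrier L. (\<forall>i<n. (\<Oplus>e\<in>S. g (c e) \<otimes> g (u e i)) = \<zero>) \<and> (\<exists>e\<in>S. g (c e) \<noteq> \<zero>)"
        using cn[OF d] h cH by (intro bexI[of _ "\<lambda>e. h (c S e)"]) auto
    qed
    then show ?thesis using eq by simp
  qed
  moreover have "u e i \<in> carrier L" if "e \<in> ground M" "i < n" for e i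
    using that vH h(1) by (simp add: u_def)
  ultimately have "representable_over L M"
    unfolding representable_over_def using ind by (intro exI[of _ n] exI[of _ u]) simp
  then show ?thesis unfolding realizable_def using L(1) by blast
qed

end

section \<open>The modular extension\<close>

text \<open>Induction on the number of skew coplanar pairs. Representability over the same
  \<open>K\<close> and hypermodularity are carried along, so that each one-element extension can be
  extended again.\<close>

lemma (in hypermodular_rank4) modular_extension:
  fixes K :: "'k ring"
  assumes K: "field K" and rep: "representable_over K M" and inf: "infinite (UNIV :: 'a set)"
  shows "\<exists>N. hypermodular_rank4 N \<and> representable_over K N \<and> modular N \<and>
    ground M \<subseteq> ground N \<and> restriction N (ground M) = M"
  using hypermodular_rank4_axioms rep
proof (induction "card (skew_coplanar_lines M)" arbitrary: M rule: less_induct)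
  case less
  interpret M: hypermodular_rank4 M by (rule less.prems)
  interpret K: scalar_field K using K by (simp add: scalar_field_def)
  show ?case
  proof (cases "skew_coplanar_lines M = {}")
    case True
    moreover have "restriction M (ground M) = M"
      using M.indep_subset by (auto simp: restriction_def intro!: matroid.equality)
    ultimately show ?thesis using M.modular_if_no_skew_lines less.prems by blast
  next
    case False
    then obtain A B where AB: "(A, B) \<in> skew_coplanar_lines M" by auto
    then have AB': "A \<subseteq> ground M" "B \<subseteq> ground M" "rk M A = 2" "rk M B = 2"
      "rk M (A \<union> B) = 3" "rk M (A \<inter> B) = 0"
      using M.flat_subset_ground by (auto simp: skew_coplanar_lines_def)
    obtain p where p: "p \<notin> ground M"
      using ex_new_if_finite[OF inf M.finite_ground] by blast
    obtain N where N: "single_extension M N p" "representable_over K N"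
      "rk N (insert p A) = rk N A" "rk N (insert p B) = rk N B"
      "rk N (A \<inter> B) < rk N (insert p (A \<inter> B))"
      using K.representable_extension_by_intersection[OF M.finite_matroid_axioms less.prems(2) AB'(1,2) _ p]
        AB' by auto
    interpret MN: single_extension M N p by (rule N(1))
    \<comment> \<open>Since \<open>A \<inter> B\<close> has rank 0, the positive rank of
      \<open>insert p (A \<inter> B)\<close> can only come from \<open>p\<close>.\<close>
    have "0 < rk N {p}"
      using N(5) MN.N.rk_submodular[of "{p}" "A \<inter> B"] MN.rk_N_eq[of "A \<inter> B"] AB'
      by (auto simp: le_infI1)
    then interpret skew_lines_extension M N p A B
      using N AB by unfold_locales
    obtain N' where N': "hypermodular_rank4 N'" "representable_over K N'" "modular N'"
      "ground N \<subseteq> ground N'" "restriction N' (ground N) = N"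
      using less.hyps[OF card_skew_coplanar_lines_less hypermodular_rank4_N N(2)] by blast
    have "restriction N' (ground M) = restriction (restriction N' (ground N)) (ground M)"
      using MN.ground_N by (auto simp: restriction_def)
    then have "restriction N' (ground M) = M"
      using N'(5) MN.restriction_N by simp
    moreover have "ground M \<subseteq> ground N'" using N'(4) MN.ground_N by blast
    ultimately show ?thesis using N' by blast
  qed
qed

theorem theorem5p5:
  fixes M :: "'a::infinite matroid"
  assumes "finite_matroid M"
    and "realizable TYPE('k) M"
    and "rk M (ground M) = 4"
    and "hypermodular M"
  shows "\<exists>N :: 'a matroid.
           finite_matroid N \<and> realizable TYPE(nat) N \<and> rk N (ground N) = 4 \<and> modular N \<and>
           ground M \<subseteq> ground N \<and> restriction N (ground M) = M"
proof -
  obtain K :: "'k ring" where K: "field K" "representable_over K M"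
    using assms(2) unfolding realizable_def by blast
  interpret hypermodular_rank4 M
    using assms by (simp add: hypermodular_rank4_def hypermodular_rank4_axioms_def)
  interpret K: scalar_field K using K(1) by (simp add: scalar_field_def)
  obtain N where N: "hypermodular_rank4 N" "representable_over K N" "modular N"
    "ground M \<subseteq> ground N" "restriction N (ground M) = M"
    using modular_extension[OF K infinite_UNIV] by blast
  interpret N: hypermodular_rank4 N by (rule N(1))
  \<comment> \<open>The construction stays over \<open>K\<close> throughout; only its final result
    is moved to a field on the natural numbers.\<close>
  have "realizable TYPE(nat) N"
    by (rule K.representable_over_imp_realizable_nat[OF N.finite_ground N(2)])
  then show ?thesis
    using N N.rk_ground N.finite_matroid_axioms by blast
qed

end
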